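(* A modified unicorn metric $F$ (in four spacetime dimensions, with positive function $f$ and nondegenerate quadratic form $\phi$) is a solution to the Finslerian (Pfeifer-Wohlfarth) field equation in vacuum if and only if $f(x^0)=c_1e^{c_2x^0}$ for constants $c_1,c_2$, i.e. if and only if it can be written as $$F=\begin{cases}c_1e^{c_2x^0}\left(|y^0|+\operatorname{sgn}(\phi)\sqrt{|\phi|}\right)\exp\!\left(\dfrac{|y^0|}{|y^0|+\operatorname{sgn}(\phi)\sqrt{|\phi|}}\right)&\text{if }|y^0|+\operatorname{sgn}(\phi)\sqrt{|\phi|}\neq0,\\[2mm]0&\text{if }|y^0|+\operatorname{sgn}(\phi)\sqrt{|\phi|}=0.\end{cases}$$
   Context: Coordinates $x^\mu$ ($\mu=0,1,2,3$; $x^0$ ranging over an interval) on a 4-dimensional manifold, induced fibre coordinates $y^\mu$ on the tangent bundle; $\partial_\mu=\partial/\partial x^\mu$, $\bar\partial_\mu=\partial/\partial y^\mu$. $\phi=\phi_{ij}y^iy^j$ ($i,j=1,2,3$) with $\phi_{ij}$ a constant, symmetric, nondegenerate matrix; $f$ is a smooth positive real-valued function of $x^0$. The modified unicorn metric is $$F=\begin{cases}f(x^0)\left(|y^0|+\operatorname{sgn}(\phi)\sqrt{|\phi|}\right)\exp\!\left(\dfrac{|y^0|}{|y^0|+\operatorname{sgn}(\phi)\sqrt{|\phi|}}\right)&\text{if }|y^0|+\operatorname{sgn}(\phi)\sqrt{|\phi|}\neq0,\\[2mm]0&\text{otherwise},\end{cases}$$ regarded as a Finsler metric on the open conic set $\mathcal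 A$ of points of the tangent bundle where it is smooth with nondegenerate $g_{\mu\nu}=\tfrac12\bar\partial_\mu\bar\partial_\nu F^2$ (in particular $y^0\neq0$, $\phi\neq0$, $|y^0|+\operatorname{sgn}(\phi)\sqrt{|\phi|}\neq0$). Put $L=F^2$, $N^\rho_\mu=\tfrac14\bar\partial_\mu[g^{\rho\sigma}(y^\lambda\partial_\lambda\bar\partial_\sigma L-\partial_\sigma L)]$, $\delta_\mu=\partial_\mu-N^\rho_\mu\bar\partial_\rho$, $G^\rho=N^\rho_\mu y^\mu$, $R^\rho_{\mu\nu}=\delta_\mu N^\rho_\nu-\delta_\nu N^\rho_\mu$, $\mathrm{Ric}=R^\mu_{\mu\nu}y^\nu$, $R_{\mu\nu}=\tfrac12\bar\partial_\mu\bar\partial_\nu\mathrm{Ric}$. The (Pfeifer-Wohlfarth) vacuum field equation in Finsler gravity (dimension 4) is, on $\mathcal A$, $$-2\,\mathrm{Ric}+\tfrac{2L}{3}g^{\mu\nu}R_{\mu\nu}+\tfrac{2L}{3}g^{\mu\nu}\big(\bar\partial_\mu(DS_\nu)-S_\mu S_\nu+\nabla^C_{\delta_\mu}S_\nu\big)=0,$$ where $S_\mu=g^{\nu\rho}S_{\mu\nu\rho}$, $S_{\mu\nu\rho}=-\tfrac14y_\sigma\bar\partial_\mu\bar\partial_\nu\bar\partial_\rho G^\sigma$ with $y_\sigma=g_{\sigma\lambda}y^\lambda$, $DS_\nu=y^\rho\delta_\rho S_\nu-N^\rho_\nu S_\rho$, and $\nabla^C_{\delta_\mu}S_\nu=\delta_\mu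 S_\nu-{}^C\Gamma^\rho_{\mu\nu}S_\rho$ with ${}^C\Gamma^\rho_{\mu\nu}=\tfrac12g^{\rho\sigma}(\delta_\mu g_{\sigma\nu}+\delta_\nu g_{\mu\sigma}-\delta_\sigma g_{\mu\nu})$. When $S_{\mu\nu\rho}=0$ it reduces to $\mathrm{Ric}-\tfrac L3g^{\mu\nu}R_{\mu\nu}=0$. *)

theory Defs
  imports "HOL-Analysis.Analysis"
begin

text \<open>
  Everything is written in a coordinate chart of a 4-dimensional manifold and the induced chart of
  its tangent bundle, so a function on the tangent bundle is a curried function of the base
  coordinates \<open>x\<close> and the fibre coordinates \<open>y\<close>. The index type \<^typ>\<open>4\<close> has the elements
  \<open>0, 1, 2, 3\<close> (with \<open>4 = 0\<close>); the index \<open>0\<close> is the time index and \<open>1, 2, 3\<close> are the spatial ones.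
\<close>

type_synonym tfun = "real ^ 4 \<Rightarrow> real ^ 4 \<Rightarrow> real"

section \<open>Smoothness\<close>

text \<open>For open \<open>S\<close> in a finite-dimensional space this is the usual notion of a \<open>C\<^sup>k\<close> function.\<close>

primrec Ck_on ::
  "nat \<Rightarrow> 'a::real_normed_vector set \<Rightarrow> ('a \<Rightarrow> 'b::real_normed_vector) \<Rightarrow> bool" where
  "Ck_on 0 S h \<longleftrightarrow> continuous_on S h"
| "Ck_on (Suc k) S h \<longleftrightarrow>
     (\<forall>z\<in>S. h differentiable (at z)) \<and> (\<forall>v. Ck_on k S (\<lambda>z. frechet_derivative h (at z) v))"

definition smooth_on :: "'a::real_normed_vector set \<Rightarrow> ('a \<Rightarrow> 'b::real_normed_vector) \<Rightarrow> bool" where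
  "smooth_on S h \<longleftrightarrow> (\<forall>k. Ck_on k S h)"

section \<open>Finsler geometry in coordinates\<close>

text \<open>The coordinate vector fields \<open>\<partial>\<^sub>\<mu>\<close> and \<open>\<partial>/\<partial>y\<^sup>\<mu>\<close>.\<close>

definition pdx :: "4 \<Rightarrow> tfun \<Rightarrow> tfun" where
  "pdx \<mu> h = (\<lambda>x y. deriv (\<lambda>t. h (x + t *\<^sub>R axis \<mu> 1) y) 0)"

definition pdy :: "4 \<Rightarrow> tfun \<Rightarrow> tfun" where
  "pdy \<mu> h = (\<lambda>x y. deriv (\<lambda>t. h x (y + t *\<^sub>R axis \<mu> 1)) 0)"

definition lagr :: "tfun \<Rightarrow> tfun" where
  "lagr F = (\<lambda>x y. (F x y)\<^sup>2)"

definition fund :: "tfun \<Rightarrow> real ^ 4 \<Rightarrow> real ^ 4 \<Rightarrow> real ^ 4 ^ 4" where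
  "fund F x y = (\<chi> \<mu> \<nu>. 1 / 2 * pdy \<mu> (pdy \<nu> (lagr F)) x y)"

definition fund_inv :: "tfun \<Rightarrow> real ^ 4 \<Rightarrow> real ^ 4 \<Rightarrow> real ^ 4 ^ 4" where
  "fund_inv F x y = matrix_inv (fund F x y)"

text \<open>In all objects below, upper indices come before lower ones: \<open>nonlin F \<rho> \<mu>\<close> is \<open>N\<^sup>\<rho>\<^sub>\<mu>\<close>,
  \<open>curv F \<rho> \<mu> \<nu>\<close> is \<open>R\<^sup>\<rho>\<^sub>\<mu>\<^sub>\<nu>\<close>, and so on.\<close>

definition nonlin :: "tfun \<Rightarrow> 4 \<Rightarrow> 4 \<Rightarrow> tfun" where
  "nonlin F \<rho> \<mu> = (\<lambda>x y. 1 / 4 * pdy \<mu> (\<lambda>x y. \<Sum>\<sigma>\<in>UNIV. fund_inv F x y $ \<rho> $ \<sigma> *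
     ((\<Sum>\<kappa>\<in>UNIV. y $ \<kappa> * pdx \<kappa> (pdy \<sigma> (lagr F)) x y) - pdx \<sigma> (lagr F) x y)) x y)"

definition hder :: "tfun \<Rightarrow> 4 \<Rightarrow> tfun \<Rightarrow> tfun" where
  "hder F \<mu> h = (\<lambda>x y. pdx \<mu> h x y - (\<Sum>\<rho>\<in>UNIV. nonlin F \<rho> \<mu> x y * pdy \<rho> h x y))"

definition spray :: "tfun \<Rightarrow> 4 \<Rightarrow> tfun" where
  "spray F \<rho> = (\<lambda>x y. \<Sum>\<mu>\<in>UNIV. nonlin F \<rho> \<mu> x y * y $ \<mu>)"

definition curv :: "tfun \<Rightarrow> 4 \<Rightarrow> 4 \<Rightarrow> 4 \<Rightarrow> tfun" where
  "curv F \<rho> \<mu> \<nu> = (\<lambda>x y. hder F \<mu> (nonlin F \<rho> \<nu>) x y - hder F \<nu> (nonlin F \<rho> \<mu>) x y)"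

definition Ric :: "tfun \<Rightarrow> tfun" where
  "Ric F = (\<lambda>x y. \<Sum>\<mu>\<in>UNIV. \<Sum>\<nu>\<in>UNIV. curv F \<mu> \<mu> \<nu> x y * y $ \<nu>)"

definition ricci_tensor :: "tfun \<Rightarrow> 4 \<Rightarrow> 4 \<Rightarrow> tfun" where
  "ricci_tensor F \<mu> \<nu> = (\<lambda>x y. 1 / 2 * pdy \<mu> (pdy \<nu> (Ric F)) x y)"

text \<open>The Landsberg tensor \<open>S\<^sub>\<mu>\<^sub>\<nu>\<^sub>\<rho>\<close> and the mean Landsberg covector \<open>S\<^sub>\<mu>\<close>.\<close>

definition landsberg :: "tfun \<Rightarrow> 4 \<Rightarrow> 4 \<Rightarrow> 4 \<Rightarrow> tfun" where
  "landsberg F \<mu> \<nu> \<rho> = (\<lambda>x y. - (1 / 4) *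
     (\<Sum>\<sigma>\<in>UNIV. (\<Sum>\<kappa>\<in>UNIV. fund F x y $ \<sigma> $ \<kappa> * y $ \<kappa>) * pdy \<mu> (pdy \<nu> (pdy \<rho> (spray F \<sigma>))) x y))"

definition mean_landsberg :: "tfun \<Rightarrow> 4 \<Rightarrow> tfun" where
  "mean_landsberg F \<mu> = (\<lambda>x y. \<Sum>\<nu>\<in>UNIV. \<Sum>\<rho>\<in>UNIV. fund_inv F x y $ \<nu> $ \<rho> * landsberg F \<mu> \<nu> \<rho> x y)"

definition dyn_mean_landsberg :: "tfun \<Rightarrow> 4 \<Rightarrow> tfun" where
  "dyn_mean_landsberg F \<nu> = (\<lambda>x y.
     (\<Sum>\<rho>\<in>UNIV. y $ \<rho> * hder F \<rho> (mean_landsberg F \<nu>) x y)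
     - (\<Sum>\<rho>\<in>UNIV. nonlin F \<rho> \<nu> x y * mean_landsberg F \<rho> x y))"

definition chern :: "tfun \<Rightarrow> 4 \<Rightarrow> 4 \<Rightarrow> 4 \<Rightarrow> tfun" where
  "chern F \<rho> \<mu> \<nu> = (\<lambda>x y. 1 / 2 * (\<Sum>\<sigma>\<in>UNIV. fund_inv F x y $ \<rho> $ \<sigma> *
     (hder F \<mu> (\<lambda>x y. fund F x y $ \<sigma> $ \<nu>) x y
      + hder F \<nu> (\<lambda>x y. fund F x y $ \<mu> $ \<sigma>) x y
      - hder F \<sigma> (\<lambda>x y. fund F x y $ \<mu> $ \<nu>) x y)))"

definition chern_mean_landsberg :: "tfun \<Rightarrow> 4 \<Rightarrow> 4 \<Rightarrow> tfun" where
  "chern_mean_landsberg F \<mu> \<nu> = (\<lambda>x y. hder F \<mu> (mean_landsberg F \<nu>) x y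
     - (\<Sum>\<rho>\<in>UNIV. chern F \<rho> \<mu> \<nu> x y * mean_landsberg F \<rho> x y))"

text \<open>The Pfeifer-Wohlfarth vacuum field equation in dimension 4 on a set of points \<open>(x, y)\<close> of the
  tangent bundle.\<close>

definition solves_PW_vacuum_on :: "((real ^ 4) \<times> (real ^ 4)) set \<Rightarrow> tfun \<Rightarrow> bool" where
  "solves_PW_vacuum_on A F \<longleftrightarrow> (\<forall>(x, y)\<in>A.
     - 2 * Ric F x y
     + 2 * lagr F x y / 3 *
         (\<Sum>\<mu>\<in>UNIV. \<Sum>\<nu>\<in>UNIV. fund_inv F x y $ \<mu> $ \<nu> * ricci_tensor F \<mu> \<nu> x y)
     + 2 * lagr F x y / 3 *
         (\<Sum>\<mu>\<in>UNIV. \<Sum>\<nu>\<in>UNIV. fund_inv F x y $ \<mu> $ \<nu> *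
            (pdy \<mu> (dyn_mean_landsberg F \<nu>) x y
             - mean_landsberg F \<mu> x y * mean_landsberg F \<nu> x y
             + chern_mean_landsberg F \<mu> \<nu> x y)) = 0)"

section \<open>The modified unicorn metric\<close>

definition spatial :: "real ^ 4 \<Rightarrow> real ^ 3" where
  "spatial y = vector [y $ 1, y $ 2, y $ 3]"

definition qform :: "real ^ 3 ^ 3 \<Rightarrow> real ^ 4 \<Rightarrow> real" where
  "qform \<phi> y = (\<Sum>i\<in>UNIV. \<Sum>j\<in>UNIV. \<phi> $ i $ j * spatial y $ i * spatial y $ j)"

definition unicorn_base :: "real ^ 3 ^ 3 \<Rightarrow> real ^ 4 \<Rightarrow> real" where
  "unicorn_base \<phi> y = \<bar>y $ 0\<bar> + sgn (qform \<phi> y) * sqrt \<bar>qform \<phi> y\<bar>"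

definition unicorn :: "(real \<Rightarrow> real) \<Rightarrow> real ^ 3 ^ 3 \<Rightarrow> tfun" where
  "unicorn f \<phi> = (\<lambda>x y.
     if unicorn_base \<phi> y \<noteq> 0
     then f (x $ 0) * unicorn_base \<phi> y * exp (\<bar>y $ 0\<bar> / unicorn_base \<phi> y)
     else 0)"

text \<open>The points of the tangent bundle over the chart domain \<open>U\<close> near which the metric is smooth and
  at which it has a nondegenerate fundamental tensor. The first three conditions on \<open>y\<close> are implied
  by smoothness near \<open>(x, y)\<close> when \<open>f\<close> is positive and \<open>\<phi>\<close> is symmetric and nondegenerate.\<close>

definition unicorn_domain ::
  "(real ^ 4) set \<Rightarrow> (real \<Rightarrow> real) \<Rightarrow> real ^ 3 ^ 3 \<Rightarrow> ((real ^ 4) \<times> (real ^ 4)) set" where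
  "unicorn_domain U f \<phi> = {(x, y). x \<in> U \<and>
     y $ 0 \<noteq> 0 \<and> qform \<phi> y \<noteq> 0 \<and> unicorn_base \<phi> y \<noteq> 0 \<and>
     (\<exists>W. open W \<and> (x, y) \<in> W \<and> W \<subseteq> U \<times> UNIV \<and> smooth_on W (\<lambda>(x, y). unicorn f \<phi> x y)) \<and>
     invertible (fund (unicorn f \<phi>) x y)}"

end

theory Submission
  imports Defs
begin

text \<open>
  Where \<open>y\<^sup>0\<close> and \<open>\<phi>\<close> have constant signs \<open>s\<close> and \<open>\<epsilon>\<close>, put \<open>u = \<bar>y\<^sup>0\<bar>\<close> and \<open>w = \<epsilon>\<surd>\<bar>\<phi>\<bar>\<close>. The
  geodesic spray of the metric is \<open>f'/f\<close> times a function of \<open>y\<close> alone, whose only non-quadratic part is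
  \<open>2 s w y\<^sup>i\<close>; as \<open>w\<^sup>2\<close> is quadratic, the Landsberg tensor vanishes, and so do all the \<open>S\<close>-terms of the
  field equation. In the Ricci scalar the terms in \<open>(f'/f)\<^sup>2\<close> cancel, which leaves
  \<open>Ric = - (f'/f)' (3 u\<^sup>2 + 4 u w + w\<^sup>2)\<close>. The left-hand side of the field equation is then
  \<open>- 2/3 (f'/f)' (u + w) (4 u\<^sup>2 + u w - w\<^sup>2) / w\<close>. The last three factors do not vanish when
  \<open>u > \<bar>w\<bar>\<close>, so the equation holds everywhere if and only if \<open>f'/f\<close> is constant.
\<close>

section \<open>Index contractions\<close>

text \<open>The operators \<open>pdx\<close> and \<open>pdy\<close> are defined through
  \<open>deriv\<close>, so an iterated derivative can be evaluated only when the inner one has a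
  closed form on a whole neighbourhood. The geometry is therefore computed on open cones where the
  absolute value and the sign are resolved, with \<open>s\<close> and \<open>\<epsilon>\<close> kept
  symbolic so that one calculation serves all four sign patterns. The algebra is kept polynomial:
  reciprocals such as \<open>v = inverse w\<close> and \<open>k = inverse ((u + w)\<^sup>2)\<close>
  are symbols of their own, and intermediate expressions are arranged so that products such as
  \<open>v * w\<close>, \<open>k * (u + w)\<^sup>2\<close>, \<open>s * s\<close> and
  \<open>\<epsilon> * \<epsilon>\<close> stand together and can be replaced by 1. The two directions
  use the cones differently. For exponential f, each point of the domain lies in the cone of its own
  signs. Conversely, a single direction y tests the equation at all times, but the points over it
  must belong to the domain; hence the smoothness and nondegeneracy proofs on the cone.\<close>

text \<open>All tensors below are combinations of a few building blocks adapted to the splitting of \<open>y\<close> into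
  \<open>y\<^sup>0\<close> and its spatial part \<open>zspat y\<close>: \<open>ltime\<close> is the covector \<open>dx\<^sup>0\<close>, \<open>kron\<close> the spatial identity, \<open>emb\<close> extends a
  spatial matrix by zero, and \<open>qlow\<close> lowers the index of \<open>y\<close> with \<open>\<phi>\<close>.\<close>

definition ltime :: "4 \<Rightarrow> real" where
  "ltime \<mu> = of_bool (\<mu> = 0)"

definition kron :: "4 \<Rightarrow> 4 \<Rightarrow> real" where
  "kron \<mu> \<nu> = of_bool (\<mu> = \<nu> \<and> \<mu> \<noteq> 0)"

definition zspat :: "real ^ 4 \<Rightarrow> 4 \<Rightarrow> real" where
  "zspat y \<mu> = (if \<mu> = 0 then 0 else y $ \<mu>)"

definition sidx :: "4 \<Rightarrow> 3" where
  "sidx \<mu> = (if \<mu> = 1 then 1 else if \<mu> = 2 then 2 else 3)"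

definition emb :: "real ^ 3 ^ 3 \<Rightarrow> 4 \<Rightarrow> 4 \<Rightarrow> real" where
  "emb M \<mu> \<nu> = (if \<mu> = 0 \<or> \<nu> = 0 then 0 else M $ sidx \<mu> $ sidx \<nu>)"

definition qlow :: "real ^ 3 ^ 3 \<Rightarrow> 4 \<Rightarrow> real ^ 4 \<Rightarrow> real" where
  "qlow \<phi> \<mu> y = (\<Sum>\<nu>\<in>UNIV. emb \<phi> \<mu> \<nu> * y $ \<nu>)"

lemma four_eq_zero: "(4::4) = 0"
  by simp

lemma sum_UNIV_4: "sum h (UNIV :: 4 set) = h 0 + h 1 + h 2 + h (3::4)" for h :: "4 \<Rightarrow> 'a::comm_monoid_add"
  unfolding sum_4 four_eq_zero by (simp add: ac_simps)

lemma qform_eq: "qform \<phi> y = (\<Sum>\<mu>\<in>UNIV. qlow \<phi> \<mu> y * y $ \<mu>)"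
  by (simp add: qform_def qlow_def sum_UNIV_4 sum_3 spatial_def emb_def sidx_def algebra_simps)

lemma four_cases: "\<mu> = 0 \<or> \<mu> = 1 \<or> \<mu> = 2 \<or> \<mu> = (3::4)"
  using exhaust_4[of \<mu>] by auto

lemma contractions:
  shows "(\<Sum>\<nu>\<in>UNIV. ltime \<nu> * ltime \<nu>) = 1"
    and "(\<Sum>\<nu>\<in>UNIV. ltime \<nu> * zspat y \<nu>) = 0"
    and "(\<Sum>\<nu>\<in>UNIV. ltime \<nu> * y $ \<nu>) = y $ 0"
    and "(\<Sum>\<nu>\<in>UNIV. ltime \<nu> * kron \<nu> \<mu>) = 0"
    and "(\<Sum>\<nu>\<in>UNIV. ltime \<nu> * kron \<mu> \<nu>) = 0"
    and "(\<Sum>\<nu>\<in>UNIV. kron \<mu> \<nu> * y $ \<nu>) = zspat y \<mu>"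
    and "(\<Sum>\<nu>\<in>UNIV. kron \<mu> \<nu> * zspat y \<nu>) = zspat y \<mu>"
    and "(\<Sum>\<nu>\<in>UNIV. ltime \<nu> * qlow \<phi> \<nu> y) = 0"
    and "(\<Sum>\<nu>\<in>UNIV. qlow \<phi> \<nu> y * y $ \<nu>) = qform \<phi> y"
    and "(\<Sum>\<nu>\<in>UNIV. qlow \<phi> \<nu> y * zspat y \<nu>) = qform \<phi> y"
    and "(\<Sum>\<nu>\<in>UNIV. kron \<mu> \<nu> * qlow \<phi> \<nu> y) = qlow \<phi> \<mu> y"
    and "(\<Sum>\<nu>\<in>UNIV. ltime \<nu> * emb M \<mu> \<nu>) = 0"
    and "(\<Sum>\<nu>\<in>UNIV. ltime \<nu> * emb M \<nu> \<mu>) = 0"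
    and "(\<Sum>\<nu>\<in>UNIV. emb \<phi> \<mu> \<nu> * y $ \<nu>) = qlow \<phi> \<mu> y"
    and "(\<Sum>\<nu>\<in>UNIV. emb \<phi> \<mu> \<nu> * zspat y \<nu>) = qlow \<phi> \<mu> y"
    and "(\<Sum>\<mu>\<in>UNIV. kron \<mu> \<mu>) = 3"
  using four_cases[of \<mu>]
  by (auto simp: sum_UNIV_4 ltime_def zspat_def kron_def qform_eq qlow_def emb_def)

lemma kron_sym: "kron \<mu> \<nu> = kron \<nu> \<mu>"
  by (auto simp: kron_def)

lemma emb_sym: "transpose \<phi> = \<phi> \<Longrightarrow> emb \<phi> \<mu> \<nu> = emb \<phi> \<nu> \<mu>"
  by (auto simp: emb_def transpose_def vec_eq_iff)

lemma emb_inverse: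
  assumes "M ** N = mat 1"
  shows "(\<Sum>\<nu>\<in>UNIV. emb M \<mu> \<nu> * emb N \<nu> \<rho>) = kron \<mu> \<rho>"
proof -
  have *: "M$i$1 * N$1$j + M$i$2 * N$2$j + M$i$3 * N$3$j = of_bool (i = j)" for i j
    using arg_cong[OF assms, of "\<lambda>A. A $ i $ j"]
    by (simp add: matrix_matrix_mult_def sum_3 mat_def)
  show ?thesis
    using four_cases[of \<mu>] four_cases[of \<rho>] *
    by (auto simp: sum_UNIV_4 emb_def sidx_def kron_def)
qed

lemma matrix_inv_mult:
  fixes A :: "real ^ 'n ^ 'n"
  assumes "invertible A"
  shows "A ** matrix_inv A = mat 1" "matrix_inv A ** A = mat 1"
  using someI_ex[OF assms[unfolded invertible_def]] unfolding matrix_inv_def by auto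

text \<open>An endomorphism of this shape is what \<open>M\<close> will be, and the sum is the term
  \<open>N^\<sigma>_\<mu> N^\<mu>_\<sigma>\<close> of the Ricci scalar. Few products survive because
  \<open>ltime\<close> is annihilated by \<open>zspat\<close> and \<open>kron\<close>.\<close>

lemma trace_square:
  fixes a b :: "4 \<Rightarrow> real"
  shows "(\<Sum>\<mu>\<in>UNIV. \<Sum>\<sigma>\<in>UNIV. (a \<mu> * ltime \<sigma> + b \<mu> * zspat y \<sigma> + c * kron \<sigma> \<mu>) *
      (a \<sigma> * ltime \<mu> + b \<sigma> * zspat y \<mu> + c * kron \<mu> \<sigma>))
    = (\<Sum>\<mu>\<in>UNIV. a \<mu> * ltime \<mu>)\<^sup>2 + 2 * (\<Sum>\<mu>\<in>UNIV. a \<mu> * zspat y \<mu>) * (\<Sum>\<mu>\<in>UNIV. b \<mu> * ltime \<mu>)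
      + (\<Sum>\<mu>\<in>UNIV. b \<mu> * zspat y \<mu>)\<^sup>2 + 2 * c * (\<Sum>\<mu>\<in>UNIV. b \<mu> * zspat y \<mu>) + 3 * c\<^sup>2"
  by (simp add: sum_UNIV_4 ltime_def zspat_def kron_def power2_eq_square algebra_simps)

lemma zspat_nth: "y $ \<rho> = y $ 0 * ltime \<rho> + zspat y \<rho>"
  by (simp add: zspat_def ltime_def)

section \<open>Partial derivatives\<close>

text \<open>The closed form \<open>h'\<close> may hold only on an open set around the point, as is
  the case for every tensor on a cone.\<close>

lemma pdy_eqI:
  assumes "open C" "y \<in> C" "\<And>y'. y' \<in> C \<Longrightarrow> h x y' = h' y'"
    and "((\<lambda>t. h' (y + t *\<^sub>R axis \<mu> 1)) has_real_derivative D) (at 0)"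
  shows "pdy \<mu> h x y = D"
proof -
  have op: "open ((\<lambda>t::real. y + t *\<^sub>R axis \<mu> 1) -` C)"
    by (intro open_vimage assms continuous_intros)
  have "((\<lambda>t. h x (y + t *\<^sub>R axis \<mu> 1)) has_real_derivative D) (at 0)"
    by (rule has_field_derivative_transform_within_open[OF assms(4) op])
       (use assms in auto)
  then show ?thesis unfolding pdy_def by (rule DERIV_imp_deriv)
qed

text \<open>The base point enters only through its time coordinate, which moves along the line in
  direction \<open>\<mu>\<close> only if \<open>\<mu> = 0\<close>; hence the factor
  \<open>ltime\<close>.\<close>

lemma pdx_eqI:
  assumes "open U" "x \<in> U" "\<And>x'. x' \<in> U \<Longrightarrow> h x' y = h' (x' $ 0)"
    and "(h' has_real_derivative D) (at (x $ 0))"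
  shows "pdx \<mu> h x y = D * ltime \<mu>"
proof -
  have op: "open ((\<lambda>t::real. x + t *\<^sub>R axis \<mu> 1) -` U)"
    by (intro open_vimage assms continuous_intros)
  have "((\<lambda>t. (x + t *\<^sub>R axis \<mu> 1) $ 0) has_real_derivative ltime \<mu>) (at 0)"
    by (auto intro!: derivative_eq_intros simp: axis_def ltime_def)
  then have "((\<lambda>t. h' ((x + t *\<^sub>R axis \<mu> 1) $ 0)) has_real_derivative D * ltime \<mu>) (at 0)"
    by (intro DERIV_chain2[of h']) (use assms(4) in auto)
  then have "((\<lambda>t. h (x + t *\<^sub>R axis \<mu> 1) y) has_real_derivative D * ltime \<mu>) (at 0)"
    by (rule has_field_derivative_transform_within_open[OF _ op]) (use assms in auto)
  then show ?thesis unfolding pdx_def by (rule DERIV_imp_deriv)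
qed

lemma DERIV_nth_line:
  "((\<lambda>t. (y + t *\<^sub>R axis \<mu> 1) $ \<nu>) has_real_derivative of_bool (\<mu> = \<nu>)) (at 0)"
  by (auto intro!: derivative_eq_intros simp: axis_def)

lemma DERIV_qlow_line:
  "((\<lambda>t. qlow \<phi> \<nu> (y + t *\<^sub>R axis \<mu> 1)) has_real_derivative emb \<phi> \<nu> \<mu>) (at 0)"
  unfolding qlow_def
  by (rule derivative_eq_intros refl DERIV_nth_line)+ (use four_cases[of \<mu>] in \<open>auto simp: sum_UNIV_4\<close>)

lemma DERIV_zspat_line:
  "((\<lambda>t. zspat (y + t *\<^sub>R axis \<mu> 1) \<nu>) has_real_derivative kron \<nu> \<mu>) (at 0)"
  unfolding zspat_def
  by (cases "\<nu> = 0") (auto intro!: derivative_eq_intros simp: kron_def axis_def)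

lemma DERIV_qform_line:
  assumes "transpose \<phi> = \<phi>"
  shows "((\<lambda>t. qform \<phi> (y + t *\<^sub>R axis \<mu> 1)) has_real_derivative 2 * qlow \<phi> \<mu> y) (at 0)"
  unfolding qform_eq
  by (rule derivative_eq_intros refl DERIV_nth_line DERIV_qlow_line)+
     (use four_cases[of \<mu>] emb_sym[OF assms] in
       \<open>auto simp: sum_UNIV_4 qlow_def algebra_simps\<close>)

section \<open>Smooth functions\<close>

text \<open>Allows the metric to be replaced by its closed form on a cone. Since \<open>S\<close> is
  open, functions that agree on it have the same Frechet derivatives there, so the induction passes
  to the next order.\<close>

lemma Ck_on_cong:
  assumes "open S" "\<And>z. z \<in> S \<Longrightarrow> g z = h z"
  shows "Ck_on k S h \<Longrightarrow> Ck_on k S g"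
  using assms(2)
proof (induction k arbitrary: g h)
  case 0
  then show ?case using continuous_on_cong by force
next
  case (Suc k)
  have D: "(g has_derivative frechet_derivative h (at z)) (at z)" if z: "z \<in> S" for z
  proof (rule has_derivative_transform_within_open[OF _ assms(1) z])
    show "(h has_derivative frechet_derivative h (at z)) (at z)"
      using Suc.prems(1) z by (simp add: frechet_derivative_works)
  qed (use Suc.prems(2) in auto)
  have "g differentiable (at z)" if "z \<in> S" for z
    using D[OF that] unfolding differentiable_def by blast
  moreover have "Ck_on k S (\<lambda>z. frechet_derivative g (at z) v)" for v
  proof (rule Suc.IH)
    show "Ck_on k S (\<lambda>z. frechet_derivative h (at z) v)" using Suc.prems(1) by simp
    show "frechet_derivative g (at z) v = frechet_derivative h (at z) v" if "z \<in> S" for z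
      using fun_cong[OF frechet_derivative_at[OF D[OF that]], of v] by (rule sym)
  qed
  ultimately show ?case by simp
qed

text \<open>A class of functions closed under directional derivatives, hence consisting of smooth functions.
  In \<open>chain\<close> the sequence \<open>g\<close> lists the successive derivatives of \<open>g 0\<close>.\<close>

inductive elementary_on :: "'a::real_normed_vector set \<Rightarrow> ('a \<Rightarrow> real) \<Rightarrow> bool" for W where
  const: "elementary_on W (\<lambda>_. c)"
| linear: "bounded_linear h \<Longrightarrow> elementary_on W h"
| add: "elementary_on W h \<Longrightarrow> elementary_on W k \<Longrightarrow> elementary_on W (\<lambda>z. h z + k z)"
| mult: "elementary_on W h \<Longrightarrow> elementary_on W k \<Longrightarrow> elementary_on W (\<lambda>z. h z * k z)"
| inverse: "elementary_on W h \<Longrightarrow> \<forall>z\<in>W. h z \<noteq> 0 \<Longrightarrow> elementary_on W (\<lambda>z. inverse (h z))"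
| sqrt: "elementary_on W h \<Longrightarrow> \<forall>z\<in>W. h z > 0 \<Longrightarrow> elementary_on W (\<lambda>z. sqrt (h z))"
| chain: "elementary_on W h \<Longrightarrow>
    \<forall>j. \<forall>z\<in>W. (g j has_real_derivative g (Suc j) (h z)) (at (h z)) \<Longrightarrow>
    elementary_on W (\<lambda>z. g (j::nat) (h z))"

lemma elementary_on_derivative:
  assumes "elementary_on W h"
  shows "\<exists>D. (\<forall>z\<in>W. (h has_derivative D z) (at z)) \<and> (\<forall>v. elementary_on W (\<lambda>z. D z v))"
  using assms
proof induction
  case (const c)
  show ?case by (rule exI[of _ "\<lambda>_ _. 0"]) (auto intro: elementary_on.const)
next
  case (linear h)
  then show ?case
    by (intro exI[of _ "\<lambda>_. h"]) (auto intro: elementary_on.const bounded_linear_imp_has_derivative)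
next
  case (add h k)
  then obtain D E where "\<forall>z\<in>W. (h has_derivative D z) (at z)" "\<forall>v. elementary_on W (\<lambda>z. D z v)"
    "\<forall>z\<in>W. (k has_derivative E z) (at z)" "\<forall>v. elementary_on W (\<lambda>z. E z v)" by blast
  then show ?case
    by (intro exI[of _ "\<lambda>z v. D z v + E z v"]) (auto intro: elementary_on.add has_derivative_add)
next
  case (mult h k)
  then obtain D E where "\<forall>z\<in>W. (h has_derivative D z) (at z)" "\<forall>v. elementary_on W (\<lambda>z. D z v)"
    "\<forall>z\<in>W. (k has_derivative E z) (at z)" "\<forall>v. elementary_on W (\<lambda>z. E z v)" by blast
  then show ?case using mult.hyps
    by (intro exI[of _ "\<lambda>z v. h z * E z v + D z v * k z"])
      (auto intro!: elementary_on.add elementary_on.mult has_derivative_mult)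
next
  case (inverse h)
  then obtain D where D: "\<forall>z\<in>W. (h has_derivative D z) (at z)" "\<forall>v. elementary_on W (\<lambda>z. D z v)"
    by blast
  have "((\<lambda>z. inverse (h z)) has_derivative (\<lambda>v. -1 * (inverse (h z) * D z v * inverse (h z)))) (at z)"
    if "z \<in> W" for z
    using D(1) inverse.hyps that by (auto intro!: derivative_eq_intros)
  moreover have "elementary_on W (\<lambda>z. -1 * (inverse (h z) * D z v * inverse (h z)))" for v
    by (intro elementary_on.mult elementary_on.const elementary_on.inverse inverse.hyps D(2)[rule_format])
  ultimately show ?case
    by (intro exI[of _ "\<lambda>z v. -1 * (inverse (h z) * D z v * inverse (h z))"]) blast
next
  case (sqrt h)
  then obtain D where D: "\<forall>z\<in>W. (h has_derivative D z) (at z)" "\<forall>v. elementary_on W (\<lambda>z. D z v)"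
    by blast
  have "((\<lambda>z. sqrt (h z)) has_derivative (\<lambda>v. 1 / 2 * (inverse (sqrt (h z)) * D z v))) (at z)"
    if "z \<in> W" for z
    using D(1) sqrt.hyps that by (auto intro!: derivative_eq_intros simp: field_simps)
  moreover have "elementary_on W (\<lambda>z. 1 / 2 * (inverse (sqrt (h z)) * D z v))" for v
    by (intro elementary_on.mult elementary_on.const elementary_on.inverse elementary_on.sqrt
        sqrt.hyps D(2)[rule_format]) (use sqrt.hyps in auto)
  ultimately show ?case
    by (intro exI[of _ "\<lambda>z v. 1 / 2 * (inverse (sqrt (h z)) * D z v)"]) blast
next
  case (chain h g j)
  then obtain D where D: "\<forall>z\<in>W. (h has_derivative D z) (at z)" "\<forall>v. elementary_on W (\<lambda>z. D z v)"
    by blast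
  have "((\<lambda>z. g j (h z)) has_derivative (\<lambda>v. g (Suc j) (h z) * D z v)) (at z)" if z: "z \<in> W" for z
  proof (rule has_derivative_compose[OF D(1)[rule_format, OF z]])
    show "(g j has_derivative (*) (g (Suc j) (h z))) (at (h z))"
      using chain.hyps(2)[rule_format, OF z, of j] by (simp only: has_field_derivative_def)
  qed
  moreover have "elementary_on W (\<lambda>z. g (Suc j) (h z) * D z v)" for v
    by (intro elementary_on.mult elementary_on.chain[of W h g] chain.hyps D(2)[rule_format])
  ultimately show ?case
    by (intro exI[of _ "\<lambda>z v. g (Suc j) (h z) * D z v"]) blast
qed

lemma elementary_on_smooth:
  assumes "open W" "elementary_on W h"
  shows "smooth_on W h"
proof -
  have "Ck_on k W h" for k
    using assms(2)
  proof (induction k arbitrary: h)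
    case 0
    then show ?case
      using elementary_on_derivative has_derivative_continuous continuous_at_imp_continuous_on
      by (metis Ck_on.simps(1))
  next
    case (Suc k)
    then obtain D where D: "\<forall>z\<in>W. (h has_derivative D z) (at z)" "\<forall>v. elementary_on W (\<lambda>z. D z v)"
      using elementary_on_derivative by blast
    have "Ck_on k W (\<lambda>z. frechet_derivative h (at z) v)" for v
      by (rule Ck_on_cong[OF assms(1) _ Suc.IH[OF D(2)[rule_format, of v]]])
        (use D(1) frechet_derivative_at in metis)
    then show ?case using D(1) by (auto simp: differentiable_def)
  qed
  then show ?thesis by (simp add: smooth_on_def)
qed

lemma elementary_on_sum:
  assumes "finite A" "\<And>i. i \<in> A \<Longrightarrow> elementary_on W (h i)"
  shows "elementary_on W (\<lambda>z. \<Sum>i\<in>A. h i z)"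
  using assms
  by (induction A rule: finite_induct) (auto intro: elementary_on.const elementary_on.add)

text \<open>On the real line the directional derivative in direction 1 is \<open>deriv\<close>, so
  each level of \<open>Ck_on\<close> yields one iterate. The sequence of iterates is what the rule
  \<open>chain\<close> expects for the factor f.\<close>

lemma Ck_on_real_DERIV:
  assumes "open I" "Ck_on n I h" "j < n" "t \<in> I"
  shows "((deriv ^^ j) h has_real_derivative (deriv ^^ Suc j) h t) (at t)"
  using assms(2,3)
proof (induction n arbitrary: h j)
  case (Suc n)
  have D: "(h has_real_derivative deriv h t) (at t)" "frechet_derivative h (at t) 1 = deriv h t"
    if t: "t \<in> I" for t
  proof -
    obtain D where D: "(h has_real_derivative D) (at t)"
      using Suc.prems(1) t real_differentiable_def by auto
    then show "(h has_real_derivative deriv h t) (at t)" using DERIV_imp_deriv by blast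
    have "frechet_derivative h (at t) = (*) D"
      using D frechet_derivative_at by (metis has_field_derivative_def)
    then show "frechet_derivative h (at t) 1 = deriv h t" using DERIV_imp_deriv[OF D] by simp
  qed
  show ?case
  proof (cases j)
    case 0
    then show ?thesis using D(1)[OF assms(4)] by simp
  next
    case (Suc i)
    have "Ck_on n I (\<lambda>z. frechet_derivative h (at z) 1)" using Suc.prems(1) by simp
    then have "Ck_on n I (deriv h)"
      by (rule Ck_on_cong[OF assms(1), rotated]) (simp add: D(2))
    then have "((deriv ^^ i) (deriv h) has_real_derivative (deriv ^^ Suc i) (deriv h) t) (at t)"
      by (rule Suc.IH) (use Suc Suc.prems in auto)
    then show ?thesis unfolding Suc by (simp only: funpow_Suc_right o_apply)
  qed
qed simp

lemma smooth_on_real_DERIV: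
  assumes "open I" "smooth_on I h" "t \<in> I"
  shows "((deriv ^^ j) h has_real_derivative (deriv ^^ Suc j) h t) (at t)"
  by (rule Ck_on_real_DERIV[OF assms(1) _ lessI assms(3)])
    (use assms(2) in \<open>simp add: smooth_on_def del: Ck_on.simps\<close>)

section \<open>The metric on a cone of constant signs\<close>

text \<open>The signs of y^0 and of the quadratic form are parameters, which turns the piecewise
  metric into a single differentiable expression. \<open>f1\<close> and \<open>f2\<close> are the
  first two derivatives of \<open>f\<close>, at the times that occur in \<open>U\<close>.\<close>

locale unicorn_cone =
  fixes U :: "(real ^ 4) set" and f f1 f2 :: "real \<Rightarrow> real" and \<phi> :: "real ^ 3 ^ 3"
    and s \<epsilon> :: real
  assumes open_U: "open U"
    and f_pos: "x \<in> U \<Longrightarrow> f (x $ 0) > 0"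
    and DERIV_f: "x \<in> U \<Longrightarrow> (f has_real_derivative f1 (x $ 0)) (at (x $ 0))"
    and DERIV_f1: "x \<in> U \<Longrightarrow> (f1 has_real_derivative f2 (x $ 0)) (at (x $ 0))"
    and transpose_phi: "transpose \<phi> = \<phi>"
    and invertible_phi: "invertible \<phi>"
    and s_sign: "s = 1 \<or> s = -1"
    and eps_sign: "\<epsilon> = 1 \<or> \<epsilon> = -1"
begin

abbreviation Q where "Q \<equiv> emb \<phi>"
abbreviation R where "R \<equiv> emb (matrix_inv \<phi>)"
abbreviation p where "p \<equiv> qlow \<phi>"

definition u :: "real ^ 4 \<Rightarrow> real" where
  "u y = s * y $ 0"

definition w :: "real ^ 4 \<Rightarrow> real" where
  "w y = \<epsilon> * sqrt (\<epsilon> * qform \<phi> y)"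

definition cone :: "(real ^ 4) set" where
  "cone = {y. u y > 0 \<and> \<epsilon> * qform \<phi> y > 0 \<and> u y + w y \<noteq> 0}"

text \<open>The square of the exponential factor of the metric, as it appears in L; hence the
  2.\<close>

definition expw :: "real ^ 4 \<Rightarrow> real" where
  "expw y = exp (2 * u y / (u y + w y))"

definition H :: "real \<Rightarrow> real" where
  "H t = f1 t / f t"

definition H1 :: "real \<Rightarrow> real" where
  "H1 t = (f2 t * f t - (f1 t)\<^sup>2) / (f t)\<^sup>2"

section \<open>Sign identities and the inverse of the quadratic form\<close>

lemma s_square: "s * s = 1" "s\<^sup>2 = 1" "s * (s * a) = a" "\<bar>s\<bar> = 1"
  and eps_square: "\<epsilon> * \<epsilon> = 1" "\<epsilon>\<^sup>2 = 1" "\<epsilon> * (\<epsilon> * a) = a" "s \<noteq> 0" "\<epsilon> \<noteq> 0"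
  using s_sign eps_sign by auto

lemma QR: "(\<Sum>\<nu>\<in>UNIV. Q \<mu> \<nu> * R \<nu> \<rho>) = kron \<mu> \<rho>"
  by (intro emb_inverse matrix_inv_mult invertible_phi)

lemma Q_sym: "Q \<mu> \<nu> = Q \<nu> \<mu>"
  by (rule emb_sym[OF transpose_phi])

lemma pR: "(\<Sum>\<nu>\<in>UNIV. p \<nu> y * R \<nu> \<rho>) = zspat y \<rho>"
proof -
  have "(\<Sum>\<nu>\<in>UNIV. p \<nu> y * R \<nu> \<rho>) = (\<Sum>\<nu>\<in>UNIV. \<Sum>\<kappa>\<in>UNIV. y $ \<kappa> * (Q \<kappa> \<nu> * R \<nu> \<rho>))"
    unfolding qlow_def sum_distrib_right by (intro sum.cong refl) (simp add: Q_sym)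
  also have "\<dots> = (\<Sum>\<kappa>\<in>UNIV. y $ \<kappa> * kron \<kappa> \<rho>)"
    by (subst sum.swap) (simp add: sum_distrib_left[symmetric] QR)
  also have "\<dots> = zspat y \<rho>"
    using contractions(6)[of \<rho> y] by (simp add: kron_sym mult.commute)
  finally show ?thesis .
qed

lemma open_cone: "open cone"
proof -
  have "continuous_on UNIV (\<lambda>y. qform \<phi> y)"
    unfolding qform_eq qlow_def by (intro continuous_intros)
  then show ?thesis
    unfolding cone_def u_def w_def
    by (intro open_Collect_conj open_Collect_less open_Collect_neq continuous_intros)
qed

lemma coneD:
  assumes "y \<in> cone"
  shows "u y > 0" "w y \<noteq> 0" "u y + w y \<noteq> 0" "(w y)\<^sup>2 = \<epsilon> * qform \<phi> y"
    "w y + u y \<noteq> 0" "qform \<phi> y = \<epsilon> * (w y)\<^sup>2" "\<epsilon> * qform \<phi> y > 0"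
  using assms by (auto simp: cone_def w_def power_mult_distrib s_square eps_square)

section \<open>Fibre derivatives of u, w and L\<close>

lemma DERIV_u_line: "((\<lambda>t. u (y + t *\<^sub>R axis \<mu> 1)) has_real_derivative s * ltime \<mu>) (at 0)"
  unfolding u_def by (rule derivative_eq_intros DERIV_nth_line refl)+ (simp add: ltime_def)

lemma DERIV_w_line:
  assumes "y \<in> cone"
  shows "((\<lambda>t. w (y + t *\<^sub>R axis \<mu> 1)) has_real_derivative \<epsilon> * p \<mu> y / w y) (at 0)"
  unfolding w_def
  using coneD(7)[OF assms]
  by (auto intro!: derivative_eq_intros DERIV_qform_line[OF transpose_phi] simp: field_simps eps_square)

lemma DERIV_expw_line:
  assumes "y \<in> cone"
  shows "((\<lambda>t. expw (y + t *\<^sub>R axis \<mu> 1)) has_real_derivative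
    expw y * (2 * w y * s * ltime \<mu> - 2 * u y * \<epsilon> * p \<mu> y / w y) / (u y + w y)\<^sup>2) (at 0)"
  unfolding expw_def
  apply (rule derivative_eq_intros DERIV_u_line DERIV_w_line[OF assms] refl)+
  using coneD[OF assms] by (auto simp: field_simps power2_eq_square)

lemma unicorn_on_cone:
  assumes "y \<in> cone"
  shows "\<bar>y $ 0\<bar> = u y" "unicorn_base \<phi> y = u y + w y"
    "unicorn f \<phi> x y = f (x $ 0) * (u y + w y) * exp (u y * inverse (u y + w y))"
proof -
  show 1: "\<bar>y $ 0\<bar> = u y" using coneD(1)[OF assms] s_sign by (auto simp: u_def)
  have "sgn (qform \<phi> y) * sqrt \<bar>qform \<phi> y\<bar> = w y"
    using coneD(7)[OF assms] eps_sign by (auto simp: w_def)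
  with 1 show 2: "unicorn_base \<phi> y = u y + w y" unfolding unicorn_base_def by (simp only:)
  show "unicorn f \<phi> x y = f (x $ 0) * (u y + w y) * exp (u y * inverse (u y + w y))"
    unfolding unicorn_def 1 2 using coneD(3)[OF assms] by (simp only: divide_inverse if_True simp_thms)
qed

lemma lagr_cone:
  assumes "y \<in> cone"
  shows "lagr (unicorn f \<phi>) x y = (f (x $ 0))\<^sup>2 * ((u y + w y)\<^sup>2 * expw y)"
  by (simp add: lagr_def unicorn_on_cone(3)[OF assms] expw_def power_mult_distrib divide_inverse
      mult.assoc exp_double[symmetric])

text \<open>The derivative of (u + w)^2 exp(2u/(u + w)) with respect to w is 2 w times the
  exponential, and this w cancels the denominator in dw = \<open>\<epsilon> * p / w\<close>. The
  derivative with respect to u supplies the coefficient u + 2 w.\<close>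

lemma pdy_lagr:
  assumes "y \<in> cone"
  shows "pdy \<mu> (lagr (unicorn f \<phi>)) x y =
    (f (x $ 0))\<^sup>2 * (2 * expw y * ((u y + 2 * w y) * s * ltime \<mu> + \<epsilon> * p \<mu> y))"
proof (rule pdy_eqI[OF open_cone assms lagr_cone], assumption)
  define k v where "k = inverse ((u y + w y)\<^sup>2)" and "v = inverse (w y)"
  have k: "k * (u y + w y)\<^sup>2 = 1" and v: "w y * v = 1"
    using coneD[OF assms] by (auto simp: k_def v_def)
  have "((\<lambda>t. (u (y + t *\<^sub>R axis \<mu> 1) + w (y + t *\<^sub>R axis \<mu> 1))\<^sup>2) has_real_derivative
    2 * (u y + w y) * (s * ltime \<mu> + \<epsilon> * p \<mu> y * v)) (at 0)"
    by (rule derivative_eq_intros DERIV_u_line DERIV_w_line[OF assms] refl)+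
      (simp add: v_def divide_inverse algebra_simps)
  moreover have "((\<lambda>t. expw (y + t *\<^sub>R axis \<mu> 1)) has_real_derivative
      expw y * (2 * w y * s * ltime \<mu> - 2 * u y * \<epsilon> * p \<mu> y * v) * k) (at 0)"
    using DERIV_expw_line[OF assms, of \<mu>] by (simp add: k_def v_def divide_inverse mult.assoc)
  ultimately have "((\<lambda>t. (f (x $ 0))\<^sup>2 * ((u (y + t *\<^sub>R axis \<mu> 1) + w (y + t *\<^sub>R axis \<mu> 1))\<^sup>2 *
       expw (y + t *\<^sub>R axis \<mu> 1))) has_real_derivative
     (f (x $ 0))\<^sup>2 * (2 * (u y + w y) * (s * ltime \<mu> + \<epsilon> * p \<mu> y * v) * expw y
       + expw y * (2 * w y * s * ltime \<mu> - 2 * u y * \<epsilon> * p \<mu> y * v) * k * (u y + w y)\<^sup>2)) (at 0)"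
    by (intro DERIV_cmult) (drule (1) DERIV_mult, simp)
  moreover have "2 * (u y + w y) * (s * ltime \<mu> + \<epsilon> * p \<mu> y * v) * expw y
       + expw y * (2 * w y * s * ltime \<mu> - 2 * u y * \<epsilon> * p \<mu> y * v) * k * (u y + w y)\<^sup>2
       = 2 * expw y * ((u y + 2 * w y) * s * ltime \<mu> + \<epsilon> * p \<mu> y)"
  proof -
    have "2 * (u y + w y) * (s * ltime \<mu> + \<epsilon> * p \<mu> y * v) * expw y
       + expw y * (2 * w y * s * ltime \<mu> - 2 * u y * \<epsilon> * p \<mu> y * v) * (k * (u y + w y)\<^sup>2)
       = 2 * expw y * ((u y + 2 * w y) * s * ltime \<mu> + (w y * v) * \<epsilon> * p \<mu> y)"
      unfolding k by (simp add: algebra_simps)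
    then show ?thesis unfolding v mult.assoc by simp
  qed
  ultimately show "((\<lambda>t. (f (x $ 0))\<^sup>2 * ((u (y + t *\<^sub>R axis \<mu> 1) + w (y + t *\<^sub>R axis \<mu> 1))\<^sup>2 *
       expw (y + t *\<^sub>R axis \<mu> 1))) has_real_derivative
     (f (x $ 0))\<^sup>2 * (2 * expw y * ((u y + 2 * w y) * s * ltime \<mu> + \<epsilon> * p \<mu> y))) (at 0)"
    by simp
qed

text \<open>On the cone, \<open>g\<^sub>\<mu>\<^sub>\<nu> = f\<^sup>2 gm\<^sub>\<mu>\<^sub>\<nu>\<close> and \<open>L g\<^sup>\<mu>\<^sup>\<nu> = gi\<^sup>\<mu>\<^sup>\<nu>\<close>. The inverse comes from the ansatz with
  unknown coefficients in the same four kinds of terms.\<close>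

definition gm :: "real ^ 4 \<Rightarrow> 4 \<Rightarrow> 4 \<Rightarrow> real" where
  "gm y \<mu> \<nu> = expw y * (((u y)\<^sup>2 + 4 * u y * w y + 5 * (w y)\<^sup>2) / (u y + w y)\<^sup>2 * ltime \<mu> * ltime \<nu>
      + s * \<epsilon> * 2 * w y / (u y + w y)\<^sup>2 * (ltime \<mu> * p \<nu> y + p \<mu> y * ltime \<nu>)
      + \<epsilon> * Q \<mu> \<nu> - 2 * u y / ((u y + w y)\<^sup>2 * w y) * p \<mu> y * p \<nu> y)"

definition gi :: "real ^ 4 \<Rightarrow> 4 \<Rightarrow> 4 \<Rightarrow> real" where
  "gi y \<mu> \<nu> = ((u y)\<^sup>2 + (w y)\<^sup>2) * ltime \<mu> * ltime \<nu>
      - 2 * s * w y * (ltime \<mu> * zspat y \<nu> + zspat y \<mu> * ltime \<nu>)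
      + (u y + w y)\<^sup>2 * \<epsilon> * R \<mu> \<nu> + 2 * (u y + 2 * w y) / w y * zspat y \<mu> * zspat y \<nu>"

lemma pdy_pdy_lagr:
  assumes "y \<in> cone"
  shows "pdy \<nu> (pdy \<mu> (lagr (unicorn f \<phi>))) x y = (f (x $ 0))\<^sup>2 * (2 * gm y \<nu> \<mu>)"
proof (rule pdy_eqI[OF open_cone assms pdy_lagr], assumption)
  define k v where "k = inverse ((u y + w y)\<^sup>2)" and "v = inverse (w y)"
  have k: "k * (u y + w y)\<^sup>2 = 1" and v: "w y * v = 1"
    using coneD[OF assms] by (auto simp: k_def v_def)
  define X where "X y = (u y + 2 * w y) * s * ltime \<mu> + \<epsilon> * p \<mu> y" for y
  define X' where "X' = (s * ltime \<nu> + 2 * \<epsilon> * p \<nu> y * v) * s * ltime \<mu> + \<epsilon> * Q \<mu> \<nu>"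
  define E' where "E' = (2 * w y * s * ltime \<nu> - 2 * u y * \<epsilon> * p \<nu> y * v) * k"
  have "((\<lambda>t. X (y + t *\<^sub>R axis \<nu> 1)) has_real_derivative X') (at 0)"
    unfolding X_def X'_def
    by (rule derivative_eq_intros DERIV_u_line DERIV_w_line[OF assms] DERIV_qlow_line refl)+
      (simp add: v_def divide_inverse algebra_simps)
  moreover have "((\<lambda>t. expw (y + t *\<^sub>R axis \<nu> 1)) has_real_derivative expw y * E') (at 0)"
    using DERIV_expw_line[OF assms, of \<nu>] by (simp add: E'_def k_def v_def divide_inverse mult.assoc)
  ultimately have D: "((\<lambda>t. (f (x $ 0))\<^sup>2 * (2 * (expw (y + t *\<^sub>R axis \<nu> 1) * X (y + t *\<^sub>R axis \<nu> 1))))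
      has_real_derivative (f (x $ 0))\<^sup>2 * (2 * (expw y * E' * X y + X' * expw y))) (at 0)"
    by (intro DERIV_cmult) (drule (1) DERIV_mult, simp)
  have "E' * X y + X' = gm y \<nu> \<mu> / expw y"
  proof -
    have "E' * X y + X' = k * (2 * w y * (u y + 2 * w y) * (s * s)) * ltime \<mu> * ltime \<nu>
        + s * s * ltime \<mu> * ltime \<nu>
        + s * \<epsilon> * (2 * w y * k * (ltime \<nu> * p \<mu> y)
        + (2 * v - 2 * u y * v * (u y + 2 * w y) * k) * (ltime \<mu> * p \<nu> y))
        + \<epsilon> * Q \<mu> \<nu> - 2 * u y * k * v * (\<epsilon> * \<epsilon>) * p \<mu> y * p \<nu> y"
      unfolding E'_def X_def X'_def by (simp add: algebra_simps)
    \<comment> \<open>Inserting k (u + w)^2 = 1 gives both terms the factor \<open>k\<close>; u^2 +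
      2 u w then cancels and w^2 remains, one factor of which absorbs \<open>v\<close>. The two
      mixed coefficients thus become equal, as symmetry requires.\<close>
    also have "2 * v - 2 * u y * v * (u y + 2 * w y) * k = 2 * v * (k * (u y + w y)\<^sup>2) - 2 * u y * v * (u y + 2 * w y) * k"
      by (simp add: k)
    also have "\<dots> = 2 * w y * k * (w y * v)"
      by (simp add: algebra_simps power2_eq_square)
    also have "k * (2 * w y * (u y + 2 * w y) * (s * s)) * ltime \<mu> * ltime \<nu> + s * s * ltime \<mu> * ltime \<nu>
       = (k * (2 * w y * (u y + 2 * w y)) + k * (u y + w y)\<^sup>2) * ltime \<mu> * ltime \<nu>"
      unfolding k s_square by (simp add: algebra_simps)
    also have "k * (2 * w y * (u y + 2 * w y)) + k * (u y + w y)\<^sup>2 = k * ((u y)\<^sup>2 + 4 * u y * w y + 5 * (w y)\<^sup>2)"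
      by (simp add: algebra_simps power2_eq_square)
    finally show ?thesis
      unfolding gm_def eps_square v by (simp add: Q_sym[of \<nu>] k_def v_def expw_def divide_inverse algebra_simps)
  qed
  then have gm: "expw y * E' * X y + X' * expw y = gm y \<nu> \<mu>"
    by (simp add: expw_def field_simps)
  show "((\<lambda>t. (f (x $ 0))\<^sup>2 * (2 * expw (y + t *\<^sub>R axis \<nu> 1) *
      ((u (y + t *\<^sub>R axis \<nu> 1) + 2 * w (y + t *\<^sub>R axis \<nu> 1)) * s * ltime \<mu>
       + \<epsilon> * p \<mu> (y + t *\<^sub>R axis \<nu> 1)))) has_real_derivative (f (x $ 0))\<^sup>2 * (2 * gm y \<nu> \<mu>)) (at 0)"
    using D[unfolded gm] unfolding X_def by (simp only: mult.assoc)
qed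

lemma fund_cone:
  assumes "y \<in> cone"
  shows "fund (unicorn f \<phi>) x y = (\<chi> \<mu> \<nu>. (f (x $ 0))\<^sup>2 * gm y \<mu> \<nu>)"
  using pdy_pdy_lagr[OF assms] by (simp add: fund_def)

text \<open>The shape shared by the rows of the metric and of the Ricci tensor, paired with the
  shape of the inverse metric. The only nonzero pairings are \<open>ltime\<close> with itself,
  \<open>p\<close> with \<open>zspat\<close> and \<open>R\<close>, and \<open>Q\<close> with
  \<open>zspat\<close> and \<open>R\<close>.\<close>

lemma bilinear_contraction:
  "(\<Sum>\<nu>\<in>UNIV. (a * ltime \<nu> + b * p \<nu> y + c * Q \<mu> \<nu>) *
     (a' * ltime \<nu> + b' * zspat y \<nu> + c' * R \<nu> \<rho>))
   = a * a' + b * b' * qform \<phi> y + b * c' * zspat y \<rho> + c * b' * p \<mu> y + c * c' * kron \<mu> \<rho>"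
proof -
  have "(\<Sum>\<nu>\<in>UNIV. (a * ltime \<nu> + b * p \<nu> y + c * Q \<mu> \<nu>) *
     (a' * ltime \<nu> + b' * zspat y \<nu> + c' * R \<nu> \<rho>))
   = a * a' * (\<Sum>\<nu>\<in>UNIV. ltime \<nu> * ltime \<nu>) + a * b' * (\<Sum>\<nu>\<in>UNIV. ltime \<nu> * zspat y \<nu>)
     + a * c' * (\<Sum>\<nu>\<in>UNIV. ltime \<nu> * R \<nu> \<rho>)
     + b * a' * (\<Sum>\<nu>\<in>UNIV. ltime \<nu> * p \<nu> y) + b * b' * (\<Sum>\<nu>\<in>UNIV. p \<nu> y * zspat y \<nu>)
     + b * c' * (\<Sum>\<nu>\<in>UNIV. p \<nu> y * R \<nu> \<rho>)
     + c * a' * (\<Sum>\<nu>\<in>UNIV. ltime \<nu> * Q \<mu> \<nu>) + c * b' * (\<Sum>\<nu>\<in>UNIV. Q \<mu> \<nu> * zspat y \<nu>)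
     + c * c' * (\<Sum>\<nu>\<in>UNIV. Q \<mu> \<nu> * R \<nu> \<rho>)"
    unfolding sum_distrib_left sum.distrib[symmetric]
    by (intro sum.cong refl) (simp add: algebra_simps)
  then show ?thesis by (simp only: contractions QR pR)
qed

text \<open>The contraction expands into five kinds of tensors. The coefficients of
  \<open>ltime \<mu> * ltime \<rho>\<close> and \<open>kron\<close> are both (u + w)^2, and these
  two tensors add up to the identity; the other three coefficients cancel.\<close>

lemma gm_gi_contr:
  assumes y: "y \<in> cone"
  shows "(\<Sum>\<nu>\<in>UNIV. gm y \<mu> \<nu> * gi y \<nu> \<rho>) = (u y + w y)\<^sup>2 * expw y * of_bool (\<mu> = \<rho>)"
proof -
  have w0: "w y \<noteq> 0" and uw: "u y + w y \<noteq> 0" using coneD[OF y] by auto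
  define k where "k = inverse ((u y + w y)\<^sup>2)"
  define v where "v = inverse (w y)"
  have k: "k * (u y + w y)\<^sup>2 = 1" and v: "v * w y = 1"
    using w0 uw by (auto simp: k_def v_def)
  define a b d where "a = ((u y)\<^sup>2 + 4 * u y * w y + 5 * (w y)\<^sup>2) * k"
    and "b = s * \<epsilon> * 2 * w y * k" and "d = 2 * u y * k * v"
  define a' b' c' d' where "a' = (u y)\<^sup>2 + (w y)\<^sup>2" and "b' = - 2 * s * w y"
    and "c' = (u y + w y)\<^sup>2 * \<epsilon>" and "d' = 2 * (u y + 2 * w y) * v"
  have gm: "gm y \<mu> \<nu> = expw y * ((a * ltime \<mu> + b * p \<mu> y) * ltime \<nu> + (b * ltime \<mu> - d * p \<mu> y) * p \<nu> y
      + \<epsilon> * Q \<mu> \<nu>)" for \<nu>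
    unfolding gm_def a_def b_def d_def k_def v_def
    by (simp add: divide_inverse algebra_simps)
  have gi: "gi y \<nu> \<rho> = (a' * ltime \<rho> + b' * zspat y \<rho>) * ltime \<nu>
      + (b' * ltime \<rho> + d' * zspat y \<rho>) * zspat y \<nu> + c' * R \<nu> \<rho>" for \<nu>
    unfolding gi_def a'_def b'_def c'_def d'_def v_def
    by (simp add: divide_inverse algebra_simps)
  have q: "qform \<phi> y = \<epsilon> * (w y)\<^sup>2" using coneD[OF y] by simp
  have "(\<Sum>\<nu>\<in>UNIV. gm y \<mu> \<nu> * gi y \<nu> \<rho>) = expw y *
     ((a * ltime \<mu> + b * p \<mu> y) * (a' * ltime \<rho> + b' * zspat y \<rho>)
      + (b * ltime \<mu> - d * p \<mu> y) * (b' * ltime \<rho> + d' * zspat y \<rho>) * qform \<phi> y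
      + (b * ltime \<mu> - d * p \<mu> y) * c' * zspat y \<rho> + \<epsilon> * (b' * ltime \<rho> + d' * zspat y \<rho>) * p \<mu> y
      + \<epsilon> * c' * kron \<mu> \<rho>)"
    unfolding gm gi mult.assoc[of "expw y"] sum_distrib_left[symmetric] bilinear_contraction ..
  also have "\<dots> = expw y * ((a * a' + b * b' * qform \<phi> y) * (ltime \<mu> * ltime \<rho>)
      + (a * b' + b * d' * qform \<phi> y + b * c') * (ltime \<mu> * zspat y \<rho>)
      + (b * a' - d * b' * qform \<phi> y + \<epsilon> * b') * (p \<mu> y * ltime \<rho>)
      + (b * b' - d * d' * qform \<phi> y - d * c' + \<epsilon> * d') * (p \<mu> y * zspat y \<rho>)
      + \<epsilon> * c' * kron \<mu> \<rho>)"
    by (simp add: algebra_simps)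
  also have "a * a' + b * b' * qform \<phi> y = (u y + w y)\<^sup>2"
  proof -
    have "a * a' + b * b' * qform \<phi> y
      = k * (((u y)\<^sup>2 + 4 * u y * w y + 5 * (w y)\<^sup>2) * ((u y)\<^sup>2 + (w y)\<^sup>2) - 4 * (w y)^4 * (s * s) * (\<epsilon> * \<epsilon>))"
      unfolding a_def b_def a'_def b'_def q by (simp add: algebra_simps power2_eq_square power4_eq_xxxx)
    also have "\<dots> = (k * (u y + w y)\<^sup>2) * (u y + w y)\<^sup>2"
      unfolding s_square eps_square by (simp add: algebra_simps power2_eq_square power4_eq_xxxx)
    finally show ?thesis by (simp add: k)
  qed
  also have "a * b' + b * d' * qform \<phi> y + b * c' = 0"
  proof -
    have "a * b' + b * d' * qform \<phi> y + b * c'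
     = 2 * s * w y * k * (- ((u y)\<^sup>2 + 4 * u y * w y + 5 * (w y)\<^sup>2) + (\<epsilon> * \<epsilon>) * 2 * (u y + 2 * w y) * (v * w y) * w y
         + (\<epsilon> * \<epsilon>) * (u y + w y)\<^sup>2)"
      unfolding a_def b_def d'_def c'_def b'_def q by (simp add: algebra_simps power2_eq_square)
    also have "\<dots> = 0"
      unfolding s_square eps_square v by (simp add: algebra_simps power2_eq_square)
    finally show ?thesis .
  qed
  also have "b * a' - d * b' * qform \<phi> y + \<epsilon> * b' = 0"
  proof -
    have "b * a' - d * b' * qform \<phi> y + \<epsilon> * b'
      = 2 * s * \<epsilon> * w y * (k * ((u y)\<^sup>2 + (w y)\<^sup>2 + 2 * u y * (v * w y) * w y) - 1)"
      unfolding b_def d_def a'_def b'_def q by (simp add: algebra_simps power2_eq_square)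
    also have "\<dots> = 2 * s * \<epsilon> * w y * (k * (u y + w y)\<^sup>2 - 1)"
      unfolding v by (simp add: algebra_simps power2_eq_square)
    finally show ?thesis by (simp add: k)
  qed
  also have "b * b' - d * d' * qform \<phi> y - d * c' + \<epsilon> * d' = 0"
  proof -
    have "b * b' - d * d' * qform \<phi> y - d * c' + \<epsilon> * d'
     = \<epsilon> * (- 4 * k * (s * s) * (w y)\<^sup>2 - 4 * u y * k * (u y + 2 * w y) * (v * w y) * (v * w y)
       - 2 * u y * v * (k * (u y + w y)\<^sup>2) + 2 * u y * v + 4 * (v * w y))"
      unfolding b_def d_def b'_def d'_def c'_def q by (simp add: algebra_simps power2_eq_square)
    also have "\<dots> = \<epsilon> * (- 4 * k * (w y)\<^sup>2 - 4 * u y * k * (u y + 2 * w y) + 4)"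
      unfolding v k s_square by simp
    also have "\<dots> = 4 * \<epsilon> * (1 - k * (u y + w y)\<^sup>2)"
      by (simp add: algebra_simps power2_eq_square)
    finally show ?thesis by (simp add: k)
  qed
  also have "\<epsilon> * c' = (u y + w y)\<^sup>2" unfolding c'_def by (simp add: s_square eps_square algebra_simps)
  finally show ?thesis by (auto simp: ltime_def kron_def algebra_simps)
qed

text \<open>A right inverse of a square matrix is its inverse. The explicit formula also shows that
  the metric is nondegenerate on the whole cone, as membership in \<open>unicorn_domain\<close>
  demands.\<close>

lemma fund_inv_cone:
  assumes x: "x \<in> U" and y: "y \<in> cone"
  shows "fund_inv (unicorn f \<phi>) x y =
      (\<chi> \<mu> \<nu>. gi y \<mu> \<nu> / ((f (x $ 0))\<^sup>2 * ((u y + w y)\<^sup>2 * expw y)))" (is "_ = ?G")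
    and "invertible (fund (unicorn f \<phi>) x y)"
proof -
  have n0: "f (x $ 0) \<noteq> 0" "expw y \<noteq> 0" "u y + w y \<noteq> 0"
    using f_pos[OF x] coneD[OF y] by (auto simp: expw_def)
  have "(\<Sum>\<nu>\<in>UNIV. (f (x $ 0))\<^sup>2 * gm y \<mu> \<nu> * (gi y \<nu> \<rho> / ((f (x $ 0))\<^sup>2 * ((u y + w y)\<^sup>2 * expw y))))
      = of_bool (\<mu> = \<rho>)" for \<mu> \<rho>
    using gm_gi_contr[OF y, of \<mu> \<rho>] n0
    by (simp add: sum_divide_distrib[symmetric] sum_distrib_left[symmetric] divide_simps mult.assoc)
  then have 1: "fund (unicorn f \<phi>) x y ** ?G = mat 1"
    by (simp add: fund_cone[OF y] matrix_matrix_mult_def mat_def vec_eq_iff)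
  show inv: "invertible (fund (unicorn f \<phi>) x y)"
    using 1 matrix_left_right_inverse[of _ ?G] unfolding invertible_def by blast
  show "fund_inv (unicorn f \<phi>) x y = ?G"
    unfolding fund_inv_def
    using arg_cong[OF 1, of "\<lambda>B. matrix_inv (fund (unicorn f \<phi>) x y) ** B"]
    by (simp add: matrix_mul_assoc matrix_inv_mult(2)[OF inv])
qed

section \<open>Raising indices with the inverse metric\<close>

lemma RQ: "(\<Sum>\<nu>\<in>UNIV. R \<mu> \<nu> * Q \<nu> \<rho>) = kron \<mu> \<rho>"
  by (intro emb_inverse matrix_inv_mult invertible_phi)

lemma Rp: "(\<Sum>\<nu>\<in>UNIV. R \<mu> \<nu> * p \<nu> y) = zspat y \<mu>"
proof -
  have "(\<Sum>\<nu>\<in>UNIV. R \<mu> \<nu> * p \<nu> y) = (\<Sum>\<nu>\<in>UNIV. \<Sum>\<kappa>\<in>UNIV. y $ \<kappa> * (R \<mu> \<nu> * Q \<nu> \<kappa>))"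
    unfolding qlow_def sum_distrib_left by (intro sum.cong refl) simp
  also have "\<dots> = (\<Sum>\<kappa>\<in>UNIV. y $ \<kappa> * kron \<mu> \<kappa>)"
    by (subst sum.swap) (simp add: sum_distrib_left[symmetric] RQ)
  also have "\<dots> = zspat y \<mu>"
    using contractions(6)[of \<mu> y] by (simp add: mult.commute)
  finally show ?thesis .
qed

text \<open>With the reciprocal as a function of its own, its derivative is again a monomial in
  \<open>v\<close>, and the fibre derivatives of the spray need no division.\<close>

definition v :: "real ^ 4 \<Rightarrow> real" where
  "v y = inverse (w y)"

lemma vw: "y \<in> cone \<Longrightarrow> v y * w y = 1"
  using coneD by (auto simp: v_def)

lemma DERIV_w_line':
  assumes "y \<in> cone"
  shows "((\<lambda>t. w (y + t *\<^sub>R axis \<mu> 1)) has_real_derivative \<epsilon> * p \<mu> y * v y) (at 0)"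
  using DERIV_w_line[OF assms, of \<mu>] by (simp add: v_def divide_inverse)

lemma DERIV_v_line:
  assumes "y \<in> cone"
  shows "((\<lambda>t. v (y + t *\<^sub>R axis \<mu> 1)) has_real_derivative - (\<epsilon> * p \<mu> y * v y ^ 3)) (at 0)"
  unfolding v_def
  apply (rule derivative_eq_intros DERIV_w_line'[OF assms] refl)+
  using coneD[OF assms] by (simp_all add: v_def power3_eq_cube)

lemma gi_contr_ltime:
  "(\<Sum>\<sigma>\<in>UNIV. gi y \<rho> \<sigma> * ltime \<sigma>) = ((u y)\<^sup>2 + (w y)\<^sup>2) * ltime \<rho> - 2 * s * w y * zspat y \<rho>"
proof -
  have "(\<Sum>\<sigma>\<in>UNIV. gi y \<rho> \<sigma> * ltime \<sigma>) =
      ((u y)\<^sup>2 + (w y)\<^sup>2) * ltime \<rho> * (\<Sum>\<sigma>\<in>UNIV. ltime \<sigma> * ltime \<sigma>)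
      - 2 * s * w y * (ltime \<rho> * (\<Sum>\<sigma>\<in>UNIV. ltime \<sigma> * zspat y \<sigma>) + zspat y \<rho> * (\<Sum>\<sigma>\<in>UNIV. ltime \<sigma> * ltime \<sigma>))
      + (u y + w y)\<^sup>2 * \<epsilon> * (\<Sum>\<sigma>\<in>UNIV. ltime \<sigma> * R \<rho> \<sigma>)
      + 2 * (u y + 2 * w y) / w y * zspat y \<rho> * (\<Sum>\<sigma>\<in>UNIV. ltime \<sigma> * zspat y \<sigma>)"
    unfolding sum_distrib_left sum.distrib[symmetric] sum_subtractf[symmetric] gi_def
    by (intro sum.cong refl) (simp add: algebra_simps)
  then show ?thesis by (simp only: contractions) simp
qed

lemma gi_contr_p:
  "(\<Sum>\<sigma>\<in>UNIV. gi y \<rho> \<sigma> * p \<sigma> y) = - 2 * s * w y * qform \<phi> y * ltime \<rho>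
     + ((u y + w y)\<^sup>2 * \<epsilon> + 2 * (u y + 2 * w y) / w y * qform \<phi> y) * zspat y \<rho>"
proof -
  have "(\<Sum>\<sigma>\<in>UNIV. gi y \<rho> \<sigma> * p \<sigma> y) =
      ((u y)\<^sup>2 + (w y)\<^sup>2) * ltime \<rho> * (\<Sum>\<sigma>\<in>UNIV. ltime \<sigma> * p \<sigma> y)
      - 2 * s * w y * (ltime \<rho> * (\<Sum>\<sigma>\<in>UNIV. p \<sigma> y * zspat y \<sigma>) + zspat y \<rho> * (\<Sum>\<sigma>\<in>UNIV. ltime \<sigma> * p \<sigma> y))
      + (u y + w y)\<^sup>2 * \<epsilon> * (\<Sum>\<sigma>\<in>UNIV. R \<rho> \<sigma> * p \<sigma> y)
      + 2 * (u y + 2 * w y) / w y * zspat y \<rho> * (\<Sum>\<sigma>\<in>UNIV. p \<sigma> y * zspat y \<sigma>)"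
    unfolding sum_distrib_left sum.distrib[symmetric] sum_subtractf[symmetric] gi_def
    by (intro sum.cong refl) (simp add: algebra_simps)
  then show ?thesis by (simp only: contractions Rp) (simp add: algebra_simps)
qed

text \<open>The covector is y_\<sigma> up to the factor \<open>f\<^sup>2 * expw\<close>, being
  proportional to the fibre gradient of L. Raising its index with L g^{\<rho>\<sigma>} must return a
  multiple of y^\<rho>.\<close>

lemma gi_contr_momentum:
  assumes y: "y \<in> cone"
  shows "(\<Sum>\<sigma>\<in>UNIV. gi y \<rho> \<sigma> * ((u y + 2 * w y) * s * ltime \<sigma> + \<epsilon> * p \<sigma> y)) = (u y + w y)\<^sup>2 * y $ \<rho>"
proof -
  have "(\<Sum>\<sigma>\<in>UNIV. gi y \<rho> \<sigma> * ((u y + 2 * w y) * s * ltime \<sigma> + \<epsilon> * p \<sigma> y)) =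
    (u y + 2 * w y) * s * (\<Sum>\<sigma>\<in>UNIV. gi y \<rho> \<sigma> * ltime \<sigma>) + \<epsilon> * (\<Sum>\<sigma>\<in>UNIV. gi y \<rho> \<sigma> * p \<sigma> y)"
    unfolding sum_distrib_left sum.distrib[symmetric]
    by (intro sum.cong refl) (simp add: algebra_simps)
  also have "\<dots> = s * ((u y + 2 * w y) * ((u y)\<^sup>2 + (w y)\<^sup>2) - 2 * (\<epsilon> * \<epsilon>) * w y * (w y)\<^sup>2) * ltime \<rho>
     + (- 2 * (s * s) * w y * (u y + 2 * w y) + (\<epsilon> * \<epsilon>) * (u y + w y)\<^sup>2
        + 2 * (\<epsilon> * \<epsilon>) * (u y + 2 * w y) * (v y * w y) * w y) * zspat y \<rho>"
    unfolding gi_contr_ltime gi_contr_p coneD(6)[OF y]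
    by (simp add: algebra_simps power2_eq_square v_def divide_inverse)
  also have "\<dots> = s * ((u y + w y)\<^sup>2 * u y) * ltime \<rho> + (u y + w y)\<^sup>2 * zspat y \<rho>"
    unfolding s_square eps_square vw[OF y] by (simp add: algebra_simps power2_eq_square)
  also have "\<dots> = (u y + w y)\<^sup>2 * ((s * s) * y $ 0 * ltime \<rho> + zspat y \<rho>)"
    by (simp add: u_def algebra_simps)
  also have "\<dots> = (u y + w y)\<^sup>2 * y $ \<rho>"
    unfolding s_square using zspat_nth[of y \<rho>] by simp
  finally show ?thesis .
qed

section \<open>The spray and the Landsberg tensor\<close>

lemma u_sq: "(u y)\<^sup>2 = (y $ 0)\<^sup>2"
  by (simp add: u_def power_mult_distrib s_square)

lemma pdx_lagr:
  assumes "x \<in> U" "y \<in> cone"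
  shows "pdx \<sigma> (lagr (unicorn f \<phi>)) x y
    = 2 * f (x $ 0) * f1 (x $ 0) * ((u y + w y)\<^sup>2 * expw y) * ltime \<sigma>"
  by (rule pdx_eqI[OF open_U assms(1), where h' = "\<lambda>t. (f t)\<^sup>2 * ((u y + w y)\<^sup>2 * expw y)"],
      rule lagr_cone[OF assms(2)])
     (auto intro!: derivative_eq_intros DERIV_f[OF assms(1)])

lemma pdx_pdy_lagr:
  assumes "x \<in> U" "y \<in> cone"
  shows "pdx \<kappa> (pdy \<sigma> (lagr (unicorn f \<phi>))) x y
    = 2 * f (x $ 0) * f1 (x $ 0) * (2 * expw y * ((u y + 2 * w y) * s * ltime \<sigma> + \<epsilon> * p \<sigma> y)) * ltime \<kappa>"
  by (rule pdx_eqI[OF open_U assms(1),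
        where h' = "\<lambda>t. (f t)\<^sup>2 * (2 * expw y * ((u y + 2 * w y) * s * ltime \<sigma> + \<epsilon> * p \<sigma> y))"],
      rule pdy_lagr[OF assms(2)])
     (auto intro!: derivative_eq_intros DERIV_f[OF assms(1)])

text \<open>With \<open>H = f'/f\<close>, the spray is \<open>H Gs\<close> and \<open>N\<^sup>\<rho>\<^sub>\<mu> = H M\<^sup>\<rho>\<^sub>\<mu>\<close>, while \<open>V\<close> is \<open>\<epsilon>\<close> times the
  Hessian of \<open>w\<close>. The functions \<open>M2\<close>, \<open>M3\<close> and \<open>V3\<close> are the fibre derivatives of \<open>M\<close> and \<open>V\<close>,
  with the indices of differentiation last.\<close>

definition Gs :: "4 \<Rightarrow> real ^ 4 \<Rightarrow> real" where
  "Gs \<rho> y = ((y $ 0)\<^sup>2 - \<epsilon> * qform \<phi> y) * ltime \<rho> + 2 * (y $ 0 + s * w y) * zspat y \<rho>"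

definition M :: "4 \<Rightarrow> 4 \<Rightarrow> real ^ 4 \<Rightarrow> real" where
  "M \<rho> \<mu> y = (y $ 0 * ltime \<mu> - \<epsilon> * p \<mu> y) * ltime \<rho>
     + (ltime \<mu> + s * \<epsilon> * p \<mu> y * v y) * zspat y \<rho> + (y $ 0 + s * w y) * kron \<rho> \<mu>"

definition V :: "4 \<Rightarrow> 4 \<Rightarrow> real ^ 4 \<Rightarrow> real" where
  "V \<mu> \<nu> y = Q \<mu> \<nu> * v y - \<epsilon> * p \<mu> y * p \<nu> y * v y ^ 3"

definition M2 :: "4 \<Rightarrow> 4 \<Rightarrow> 4 \<Rightarrow> real ^ 4 \<Rightarrow> real" where
  "M2 \<rho> \<mu> \<nu> y = (ltime \<mu> * ltime \<nu> - \<epsilon> * Q \<mu> \<nu>) * ltime \<rho> + s * \<epsilon> * V \<mu> \<nu> y * zspat y \<rho>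
     + (ltime \<mu> + s * \<epsilon> * p \<mu> y * v y) * kron \<rho> \<nu> + (ltime \<nu> + s * \<epsilon> * p \<nu> y * v y) * kron \<rho> \<mu>"

definition V3 :: "4 \<Rightarrow> 4 \<Rightarrow> 4 \<Rightarrow> real ^ 4 \<Rightarrow> real" where
  "V3 \<mu> \<nu> \<kappa> y = - \<epsilon> * (Q \<mu> \<nu> * p \<kappa> y + Q \<mu> \<kappa> * p \<nu> y + Q \<nu> \<kappa> * p \<mu> y) * v y ^ 3
     + 3 * p \<mu> y * p \<nu> y * p \<kappa> y * v y ^ 5"

definition M3 :: "4 \<Rightarrow> 4 \<Rightarrow> 4 \<Rightarrow> 4 \<Rightarrow> real ^ 4 \<Rightarrow> real" where
  "M3 \<rho> \<mu> \<nu> \<kappa> y = s * \<epsilon> * (V3 \<mu> \<nu> \<kappa> y * zspat y \<rho> + V \<mu> \<nu> y * kron \<rho> \<kappa>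
     + V \<mu> \<kappa> y * kron \<rho> \<nu> + V \<nu> \<kappa> y * kron \<rho> \<mu>)"

section \<open>Fibre derivatives of the spray\<close>

lemma DERIV_nth0_line:
  "((\<lambda>t. (y + t *\<^sub>R axis \<mu> 1) $ 0) has_real_derivative ltime \<mu>) (at 0)"
  using DERIV_nth_line[of y \<mu> 0] by (simp add: ltime_def)

lemma DERIV_Gs_line:
  assumes "y \<in> cone"
  shows "((\<lambda>t. Gs \<rho> (y + t *\<^sub>R axis \<mu> 1)) has_real_derivative 2 * M \<rho> \<mu> y) (at 0)"
  unfolding Gs_def M_def
  by (rule derivative_eq_intros DERIV_nth0_line DERIV_w_line'[OF assms] DERIV_qform_line[OF transpose_phi]
      DERIV_zspat_line refl)+
     (simp add: algebra_simps)

lemma DERIV_M_line: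
  assumes "y \<in> cone"
  shows "((\<lambda>t. M \<rho> \<mu> (y + t *\<^sub>R axis \<nu> 1)) has_real_derivative M2 \<rho> \<mu> \<nu> y) (at 0)"
  unfolding M_def M2_def V_def
  by (rule derivative_eq_intros DERIV_nth0_line DERIV_w_line'[OF assms] DERIV_v_line[OF assms]
      DERIV_qlow_line DERIV_zspat_line refl)+
     (simp add: algebra_simps)

lemma DERIV_V_line:
  assumes "y \<in> cone"
  shows "((\<lambda>t. V \<mu> \<nu> (y + t *\<^sub>R axis \<kappa> 1)) has_real_derivative V3 \<mu> \<nu> \<kappa> y) (at 0)"
  unfolding V_def V3_def
  by (rule derivative_eq_intros DERIV_v_line[OF assms] DERIV_qlow_line refl)+
     (simp add: algebra_simps eps_square power_numeral_reduce)

lemma DERIV_M2_line: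
  assumes "y \<in> cone"
  shows "((\<lambda>t. M2 \<rho> \<mu> \<nu> (y + t *\<^sub>R axis \<kappa> 1)) has_real_derivative M3 \<rho> \<mu> \<nu> \<kappa> y) (at 0)"
  unfolding M2_def M3_def
  by (rule derivative_eq_intros DERIV_v_line[OF assms] DERIV_V_line[OF assms]
      DERIV_qlow_line DERIV_zspat_line refl)+
     (simp add: algebra_simps V_def Q_sym)

text \<open>Euler's identity: \<open>Gs\<close> is homogeneous of degree two and \<open>M\<close> is
  half its gradient.\<close>

lemma M_contr: 
  assumes y: "y \<in> cone"
  shows "(\<Sum>\<mu>\<in>UNIV. M \<rho> \<mu> y * y $ \<mu>) = Gs \<rho> y"
proof -
  have "(\<Sum>\<mu>\<in>UNIV. M \<rho> \<mu> y * y $ \<mu>) =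
     (y $ 0 * (\<Sum>\<mu>\<in>UNIV. ltime \<mu> * y $ \<mu>) - \<epsilon> * (\<Sum>\<mu>\<in>UNIV. p \<mu> y * y $ \<mu>)) * ltime \<rho>
     + ((\<Sum>\<mu>\<in>UNIV. ltime \<mu> * y $ \<mu>) + s * \<epsilon> * v y * (\<Sum>\<mu>\<in>UNIV. p \<mu> y * y $ \<mu>)) * zspat y \<rho>
     + (y $ 0 + s * w y) * (\<Sum>\<mu>\<in>UNIV. kron \<rho> \<mu> * y $ \<mu>)"
    unfolding sum_distrib_left sum_distrib_right sum.distrib[symmetric] sum_subtractf[symmetric] M_def
    by (intro sum.cong refl) (simp add: algebra_simps)
  also have "\<dots> = (y $ 0 * y $ 0 - \<epsilon> * qform \<phi> y) * ltime \<rho>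
     + (y $ 0 + s * (\<epsilon> * \<epsilon>) * (v y * w y) * w y) * zspat y \<rho> + (y $ 0 + s * w y) * zspat y \<rho>"
    by (simp only: contractions) (simp add: coneD(6)[OF y] power2_eq_square)
  finally show ?thesis
    unfolding vw[OF y] eps_square by (simp add: Gs_def power2_eq_square algebra_simps)
qed

text \<open>The function w is homogeneous of degree one, so its Hessian annihilates y; as it also
  ignores the time direction, the spatial part of y gives the same.\<close>

lemma V_contr:
  assumes y: "y \<in> cone"
  shows "(\<Sum>\<mu>\<in>UNIV. V \<mu> \<nu> y * y $ \<mu>) = 0" "(\<Sum>\<mu>\<in>UNIV. V \<mu> \<nu> y * zspat y \<mu>) = 0"
proof -
  have 1: "(\<Sum>\<mu>\<in>UNIV. V \<mu> \<nu> y * g \<mu>) = v y * (\<Sum>\<mu>\<in>UNIV. Q \<nu> \<mu> * g \<mu>)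
      - \<epsilon> * p \<nu> y * v y ^ 3 * (\<Sum>\<mu>\<in>UNIV. p \<mu> y * g \<mu>)" for g
    unfolding sum_distrib_left sum_subtractf[symmetric] V_def
    by (intro sum.cong refl) (simp add: algebra_simps Q_sym)
  have 2: "v y * p \<nu> y - \<epsilon> * p \<nu> y * v y ^ 3 * qform \<phi> y = 0"
  proof -
    have "\<epsilon> * p \<nu> y * v y ^ 3 * qform \<phi> y = (\<epsilon> * \<epsilon>) * p \<nu> y * v y * (v y * w y) * (v y * w y)"
      unfolding coneD(6)[OF y] by (simp add: power2_eq_square power3_eq_cube)
    then show ?thesis unfolding vw[OF y] eps_square by auto
  qed
  show "(\<Sum>\<mu>\<in>UNIV. V \<mu> \<nu> y * y $ \<mu>) = 0" "(\<Sum>\<mu>\<in>UNIV. V \<mu> \<nu> y * zspat y \<mu>) = 0"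
    unfolding 1 contractions by (fact 2)+
qed

text \<open>Euler's identity for \<open>M\<close>, of degree one. \<open>M2\<close> is symmetric in
  its lower indices, so it is immaterial which of them is contracted.\<close>

lemma M2_contr:
  assumes y: "y \<in> cone"
  shows "(\<Sum>\<nu>\<in>UNIV. M2 \<mu> \<nu> \<sigma> y * y $ \<nu>) = M \<mu> \<sigma> y"
proof -
  have "(\<Sum>\<nu>\<in>UNIV. M2 \<mu> \<nu> \<sigma> y * y $ \<nu>) =
     ((\<Sum>\<nu>\<in>UNIV. ltime \<nu> * y $ \<nu>) * ltime \<sigma> - \<epsilon> * (\<Sum>\<nu>\<in>UNIV. Q \<sigma> \<nu> * y $ \<nu>)) * ltime \<mu>
     + s * \<epsilon> * zspat y \<mu> * (\<Sum>\<nu>\<in>UNIV. V \<nu> \<sigma> y * y $ \<nu>)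
     + ((\<Sum>\<nu>\<in>UNIV. ltime \<nu> * y $ \<nu>) + s * \<epsilon> * v y * (\<Sum>\<nu>\<in>UNIV. p \<nu> y * y $ \<nu>)) * kron \<mu> \<sigma>
     + (ltime \<sigma> + s * \<epsilon> * p \<sigma> y * v y) * (\<Sum>\<nu>\<in>UNIV. kron \<mu> \<nu> * y $ \<nu>)"
    unfolding sum_distrib_left sum_distrib_right sum.distrib[symmetric] sum_subtractf[symmetric] M2_def
    by (intro sum.cong refl) (simp add: algebra_simps Q_sym)
  also have "\<dots> = (y $ 0 * ltime \<sigma> - \<epsilon> * p \<sigma> y) * ltime \<mu>
     + (y $ 0 + s * (\<epsilon> * \<epsilon>) * (v y * w y) * w y) * kron \<mu> \<sigma>
     + (ltime \<sigma> + s * \<epsilon> * p \<sigma> y * v y) * zspat y \<mu>"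
    by (simp only: contractions V_contr[OF y]) (simp add: coneD(6)[OF y] power2_eq_square)
  finally show ?thesis
    unfolding vw[OF y] eps_square by (simp add: M_def power2_eq_square)
qed

text \<open>L depends on the base point only through the factor f^2, so its time derivative is 2 H
  L, and the term y^\<kappa> contributes y_\<sigma>, whose index is raised by
  \<open>gi_contr_momentum\<close>. The bracket becomes 2 H \<open>Gs\<close>, and its gradient 4 H
  \<open>M\<close> meets the factor 1/4.\<close>

lemma nonlin_cone:
  assumes x: "x \<in> U" and y: "y \<in> cone"
  shows "nonlin (unicorn f \<phi>) \<rho> \<mu> x y = H (x $ 0) * M \<rho> \<mu> y"
proof -
  \<comment> \<open>Stated for every \<open>y\<close> in the cone, since the expression is
    differentiated afterwards.\<close>
  have bracket: "(\<Sum>\<sigma>\<in>UNIV. fund_inv (unicorn f \<phi>) x y $ \<rho> $ \<sigma> *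
     ((\<Sum>\<kappa>\<in>UNIV. y $ \<kappa> * pdx \<kappa> (pdy \<sigma> (lagr (unicorn f \<phi>))) x y) - pdx \<sigma> (lagr (unicorn f \<phi>)) x y))
     = H (x $ 0) * 2 * Gs \<rho> y" if y: "y \<in> cone" for y
  proof -
    have n0: "f (x $ 0) \<noteq> 0" "expw y \<noteq> 0" "u y + w y \<noteq> 0" "(u y + w y)\<^sup>2 \<noteq> 0"
      using f_pos[OF x] coneD[OF y] by (auto simp: expw_def)
    define L where "L = (f (x $ 0))\<^sup>2 * ((u y + w y)\<^sup>2 * expw y)"
    define X where "X \<sigma> = (u y + 2 * w y) * s * ltime \<sigma> + \<epsilon> * p \<sigma> y" for \<sigma>
    have "(\<Sum>\<kappa>\<in>UNIV. y $ \<kappa> * pdx \<kappa> (pdy \<sigma> (lagr (unicorn f \<phi>))) x y)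
       = 2 * f (x $ 0) * f1 (x $ 0) * (2 * expw y * X \<sigma>) * (\<Sum>\<kappa>\<in>UNIV. ltime \<kappa> * y $ \<kappa>)" for \<sigma>
      unfolding pdx_pdy_lagr[OF x y] sum_distrib_left X_def by (intro sum.cong refl) simp
    then have 1: "(\<Sum>\<kappa>\<in>UNIV. y $ \<kappa> * pdx \<kappa> (pdy \<sigma> (lagr (unicorn f \<phi>))) x y)
       = 2 * f (x $ 0) * f1 (x $ 0) * (2 * expw y * X \<sigma>) * y $ 0" for \<sigma>
      by (simp only: contractions)
    have "(\<Sum>\<sigma>\<in>UNIV. fund_inv (unicorn f \<phi>) x y $ \<rho> $ \<sigma> *
     ((\<Sum>\<kappa>\<in>UNIV. y $ \<kappa> * pdx \<kappa> (pdy \<sigma> (lagr (unicorn f \<phi>))) x y) - pdx \<sigma> (lagr (unicorn f \<phi>)) x y))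
     = 2 * f (x $ 0) * f1 (x $ 0) * expw y / L * (2 * y $ 0 * (\<Sum>\<sigma>\<in>UNIV. gi y \<rho> \<sigma> * X \<sigma>)
       - (u y + w y)\<^sup>2 * (\<Sum>\<sigma>\<in>UNIV. gi y \<rho> \<sigma> * ltime \<sigma>))"
      unfolding 1 pdx_lagr[OF x y] fund_inv_cone(1)[OF x y] L_def[symmetric] vec_lambda_beta
      unfolding sum_distrib_left sum_subtractf[symmetric]
      by (intro sum.cong refl) (simp add: algebra_simps diff_divide_distrib)
    also have "\<dots> = 2 * f (x $ 0) * f1 (x $ 0) * expw y / L * (u y + w y)\<^sup>2 *
        (2 * y $ 0 * y $ \<rho> - (((u y)\<^sup>2 + (w y)\<^sup>2) * ltime \<rho> - 2 * s * w y * zspat y \<rho>))"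
      unfolding X_def gi_contr_momentum[OF y] gi_contr_ltime
      by (simp only: right_diff_distrib mult.assoc mult.left_commute[of "(u y + w y)\<^sup>2"])
    also have "2 * f (x $ 0) * f1 (x $ 0) * expw y / L * (u y + w y)\<^sup>2 = 2 * H (x $ 0)"
      unfolding L_def H_def using n0 by (simp add: divide_simps power2_eq_square)
    also have "2 * y $ 0 * y $ \<rho> - (((u y)\<^sup>2 + (w y)\<^sup>2) * ltime \<rho> - 2 * s * w y * zspat y \<rho>)
       = ((y $ 0)\<^sup>2 - (w y)\<^sup>2) * ltime \<rho> + 2 * (y $ 0 + s * w y) * zspat y \<rho>"
      unfolding u_sq zspat_nth[of y \<rho>] by (simp add: algebra_simps power2_eq_square)
    finally show ?thesis by (simp add: Gs_def coneD(4)[OF y])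
  qed
  have "pdy \<mu> (\<lambda>x y. \<Sum>\<sigma>\<in>UNIV. fund_inv (unicorn f \<phi>) x y $ \<rho> $ \<sigma> *
     ((\<Sum>\<kappa>\<in>UNIV. y $ \<kappa> * pdx \<kappa> (pdy \<sigma> (lagr (unicorn f \<phi>))) x y) - pdx \<sigma> (lagr (unicorn f \<phi>)) x y)) x y
     = H (x $ 0) * 2 * (2 * M \<rho> \<mu> y)"
    by (rule pdy_eqI[OF open_cone y, where h' = "\<lambda>y. H (x $ 0) * 2 * Gs \<rho> y"], erule bracket) (intro DERIV_cmult DERIV_Gs_line y)
  then show ?thesis unfolding nonlin_def by simp
qed

lemma spray_cone:
  assumes x: "x \<in> U" and y: "y \<in> cone"
  shows "spray (unicorn f \<phi>) \<rho> x y = H (x $ 0) * Gs \<rho> y"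
  unfolding spray_def nonlin_cone[OF x y] mult.assoc sum_distrib_left[symmetric] M_contr[OF y] ..

text \<open>Only w z^\<sigma>, with z the spatial part of y, survives three fibre derivatives of the
  spray. Contracting with y_\<sigma>, and using that \<open>\<epsilon> * p\<close> is w dw and its
  pairing with z is w^2, turns the sum into w times half the third derivative of w^2. That
  derivative is zero because w^2 is quadratic.\<close>

lemma landsberg_cone:
  assumes x: "x \<in> U" and y: "y \<in> cone"
  shows "landsberg (unicorn f \<phi>) \<mu> \<nu> \<rho> x y = 0"
proof -
  have 1: "pdy \<rho> (spray (unicorn f \<phi>) \<sigma>) x y = H (x $ 0) * (2 * M \<sigma> \<rho> y)" if "y \<in> cone" for \<sigma> y
    by (rule pdy_eqI[OF open_cone that, where h' = "\<lambda>y. H (x $ 0) * Gs \<sigma> y"], erule spray_cone[OF x]) (intro DERIV_cmult DERIV_Gs_line that)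
  have 2: "pdy \<nu> (pdy \<rho> (spray (unicorn f \<phi>) \<sigma>)) x y = H (x $ 0) * (2 * M2 \<sigma> \<rho> \<nu> y)" if "y \<in> cone" for \<sigma> y
    by (rule pdy_eqI[OF open_cone that, where h' = "\<lambda>y. H (x $ 0) * (2 * M \<sigma> \<rho> y)"], erule 1) (intro DERIV_cmult DERIV_M_line that)
  have 3: "pdy \<mu> (pdy \<nu> (pdy \<rho> (spray (unicorn f \<phi>) \<sigma>))) x y = H (x $ 0) * (2 * M3 \<sigma> \<rho> \<nu> \<mu> y)" for \<sigma>
    by (rule pdy_eqI[OF open_cone y, where h' = "\<lambda>y. H (x $ 0) * (2 * M2 \<sigma> \<rho> \<nu> y)"], erule 2) (intro DERIV_cmult DERIV_M2_line y)
  define k where "k = inverse ((u y + w y)\<^sup>2)"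
  have k: "k * (u y + w y)\<^sup>2 = 1" using coneD[OF y] by (auto simp: k_def)
  \<comment> \<open>This is y_\<sigma>, half the fibre gradient of L by homogeneity; hence the
    covector from \<open>pdy_lagr\<close> returns.\<close>
  have g: "(\<Sum>\<kappa>\<in>UNIV. fund (unicorn f \<phi>) x y $ \<sigma> $ \<kappa> * y $ \<kappa>)
     = (f (x $ 0))\<^sup>2 * expw y * ((u y + 2 * w y) * s * ltime \<sigma> + \<epsilon> * p \<sigma> y)" for \<sigma>
  proof -
    have "(\<Sum>\<kappa>\<in>UNIV. fund (unicorn f \<phi>) x y $ \<sigma> $ \<kappa> * y $ \<kappa>) = (f (x $ 0))\<^sup>2 * expw y *
      (((u y)\<^sup>2 + 4 * u y * w y + 5 * (w y)\<^sup>2) * k * ltime \<sigma> * (\<Sum>\<kappa>\<in>UNIV. ltime \<kappa> * y $ \<kappa>)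
      + s * \<epsilon> * 2 * w y * k * (ltime \<sigma> * (\<Sum>\<kappa>\<in>UNIV. p \<kappa> y * y $ \<kappa>) + p \<sigma> y * (\<Sum>\<kappa>\<in>UNIV. ltime \<kappa> * y $ \<kappa>))
      + \<epsilon> * (\<Sum>\<kappa>\<in>UNIV. Q \<sigma> \<kappa> * y $ \<kappa>)
      - 2 * u y * k * v y * p \<sigma> y * (\<Sum>\<kappa>\<in>UNIV. p \<kappa> y * y $ \<kappa>))"
      unfolding fund_cone[OF y] vec_lambda_beta gm_def sum_distrib_left sum.distrib[symmetric] sum_subtractf[symmetric]
      by (intro sum.cong refl) (simp add: k_def v_def divide_inverse algebra_simps)
    also have "\<dots> = (f (x $ 0))\<^sup>2 * expw y *
      (((u y)\<^sup>2 + 4 * u y * w y + 5 * (w y)\<^sup>2) * k * ltime \<sigma> * y $ 0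
      + s * \<epsilon> * 2 * w y * k * (ltime \<sigma> * (\<epsilon> * (w y)\<^sup>2) + p \<sigma> y * y $ 0)
      + \<epsilon> * p \<sigma> y - 2 * u y * k * v y * p \<sigma> y * (\<epsilon> * (w y)\<^sup>2))"
      unfolding contractions coneD(6)[OF y] ..
    also have "y $ 0 = s * u y" by (simp add: u_def s_square)
    also have "((u y)\<^sup>2 + 4 * u y * w y + 5 * (w y)\<^sup>2) * k * ltime \<sigma> * (s * u y)
      + s * \<epsilon> * 2 * w y * k * (ltime \<sigma> * (\<epsilon> * (w y)\<^sup>2) + p \<sigma> y * (s * u y))
      + \<epsilon> * p \<sigma> y - 2 * u y * k * v y * p \<sigma> y * (\<epsilon> * (w y)\<^sup>2)
      = s * k * (((u y)\<^sup>2 + 4 * u y * w y + 5 * (w y)\<^sup>2) * u y + 2 * (\<epsilon> * \<epsilon>) * w y * (w y)\<^sup>2) * ltime \<sigma>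
       + \<epsilon> * p \<sigma> y * (2 * u y * w y * k * (s * s) + 1 - 2 * u y * w y * k * (v y * w y))"
      by (simp add: algebra_simps power2_eq_square)
    also have "\<dots> = s * ((k * (u y + w y)\<^sup>2) * (u y + 2 * w y)) * ltime \<sigma> + \<epsilon> * p \<sigma> y"
      unfolding s_square eps_square vw[OF y] by (simp add: algebra_simps power2_eq_square)
    finally show ?thesis unfolding k by (simp add: algebra_simps)
  qed
  have "(\<Sum>\<sigma>\<in>UNIV. ((u y + 2 * w y) * s * ltime \<sigma> + \<epsilon> * p \<sigma> y) * M3 \<sigma> \<rho> \<nu> \<mu> y) = 0"
  proof -
    have kp: "(\<Sum>\<sigma>\<in>UNIV. p \<sigma> y * kron \<sigma> \<kappa>) = p \<kappa> y" for \<kappa>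
      using contractions(11)[of \<kappa> \<phi> y] by (simp add: kron_sym mult.commute)
    define X where "X \<sigma> = (u y + 2 * w y) * s * ltime \<sigma> + \<epsilon> * p \<sigma> y" for \<sigma>
    have X: "(\<Sum>\<sigma>\<in>UNIV. X \<sigma> * h \<sigma>) = (u y + 2 * w y) * s * (\<Sum>\<sigma>\<in>UNIV. ltime \<sigma> * h \<sigma>)
        + \<epsilon> * (\<Sum>\<sigma>\<in>UNIV. p \<sigma> y * h \<sigma>)" for h
      unfolding sum_distrib_left sum.distrib[symmetric] X_def
      by (intro sum.cong refl) (simp add: algebra_simps)
    have Xz: "(\<Sum>\<sigma>\<in>UNIV. X \<sigma> * zspat y \<sigma>) = \<epsilon> * qform \<phi> y"
      and Xk: "(\<Sum>\<sigma>\<in>UNIV. X \<sigma> * kron \<sigma> \<kappa>) = \<epsilon> * p \<kappa> y" for \<kappa>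
      unfolding X contractions kp by simp_all
    have "(\<Sum>\<sigma>\<in>UNIV. X \<sigma> * M3 \<sigma> \<rho> \<nu> \<mu> y) = s * \<epsilon> * (V3 \<rho> \<nu> \<mu> y * (\<Sum>\<sigma>\<in>UNIV. X \<sigma> * zspat y \<sigma>)
       + V \<rho> \<nu> y * (\<Sum>\<sigma>\<in>UNIV. X \<sigma> * kron \<sigma> \<mu>) + V \<rho> \<mu> y * (\<Sum>\<sigma>\<in>UNIV. X \<sigma> * kron \<sigma> \<nu>)
       + V \<nu> \<mu> y * (\<Sum>\<sigma>\<in>UNIV. X \<sigma> * kron \<sigma> \<rho>))"
      unfolding M3_def sum_distrib_left sum.distrib[symmetric]
      by (intro sum.cong refl) (simp add: algebra_simps)
    also have "\<dots> = s * \<epsilon> * (V3 \<rho> \<nu> \<mu> y * (w y)\<^sup>2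
       + \<epsilon> * (V \<rho> \<nu> y * p \<mu> y + V \<rho> \<mu> y * p \<nu> y + V \<nu> \<mu> y * p \<rho> y))"
      unfolding Xz Xk coneD(4)[OF y, symmetric] by (simp add: algebra_simps)
    also have "V3 \<rho> \<nu> \<mu> y * (w y)\<^sup>2 = - \<epsilon> * (Q \<rho> \<nu> * p \<mu> y + Q \<rho> \<mu> * p \<nu> y + Q \<nu> \<mu> * p \<rho> y) * v y * (v y * w y) * (v y * w y)
     + 3 * p \<rho> y * p \<nu> y * p \<mu> y * v y ^ 3 * (v y * w y) * (v y * w y)"
      unfolding V3_def by (simp add: algebra_simps power_numeral_reduce)
    also have "s * \<epsilon> * (\<dots> + \<epsilon> * (V \<rho> \<nu> y * p \<mu> y + V \<rho> \<mu> y * p \<nu> y + V \<nu> \<mu> y * p \<rho> y))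
      = s * \<epsilon> * (3 * p \<rho> y * p \<nu> y * p \<mu> y * v y ^ 3 * (1 - \<epsilon> * \<epsilon>))"
      unfolding vw[OF y] V_def by (simp add: algebra_simps)
    finally show ?thesis unfolding X_def by (simp add: eps_square)
  qed
  moreover have "(\<Sum>\<sigma>\<in>UNIV. (f (x $ 0))\<^sup>2 * expw y * ((u y + 2 * w y) * s * ltime \<sigma> + \<epsilon> * p \<sigma> y) *
      (H (x $ 0) * (2 * M3 \<sigma> \<rho> \<nu> \<mu> y))) = (f (x $ 0))\<^sup>2 * expw y * H (x $ 0) * 2 *
      (\<Sum>\<sigma>\<in>UNIV. ((u y + 2 * w y) * s * ltime \<sigma> + \<epsilon> * p \<sigma> y) * M3 \<sigma> \<rho> \<nu> \<mu> y)"
    unfolding sum_distrib_left by (intro sum.cong refl) (simp only: ac_simps)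
  ultimately show ?thesis unfolding landsberg_def g 3 by simp
qed

section \<open>Derivative of f'/f and vanishing of the S-terms\<close>

lemma DERIV_H:
  assumes "x \<in> U"
  shows "(H has_real_derivative H1 (x $ 0)) (at (x $ 0))"
proof -
  have "f (x $ 0) \<noteq> 0" using f_pos[OF assms] by simp
  then show ?thesis unfolding H_def H1_def
    by (auto intro!: derivative_eq_intros DERIV_f[OF assms] DERIV_f1[OF assms] simp: power2_eq_square)
qed

text \<open>The S-terms contain derivatives of the mean Landsberg covector. These vanish because the
  covector is zero on open sets in both x and y, not merely at one point.\<close>

lemma derivatives_of_zero:
  assumes "x \<in> U" "y \<in> cone" "\<And>x y. x \<in> U \<Longrightarrow> y \<in> cone \<Longrightarrow> h x y = 0"
  shows "pdx \<mu> h x y = 0" "pdy \<mu> h x y = 0" "hder (unicorn f \<phi>) \<mu> h x y = 0"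
proof -
  show 1: "pdx \<mu> h x y = 0" for \<mu>
    using pdx_eqI[OF open_U assms(1), of h y "\<lambda>_. 0" 0] assms by auto
  show 2: "pdy \<mu> h x y = 0" for \<mu>
    using pdy_eqI[OF open_cone assms(2), of h x "\<lambda>_. 0"] assms by auto
  show "hder (unicorn f \<phi>) \<mu> h x y = 0"
    by (simp add: hder_def 1 2)
qed

lemma mean_landsberg_cone:
  assumes "x \<in> U" "y \<in> cone"
  shows "mean_landsberg (unicorn f \<phi>) \<mu> x y = 0"
  by (simp add: mean_landsberg_def landsberg_cone[OF assms])

lemma dyn_mean_landsberg_cone:
  assumes "x \<in> U" "y \<in> cone"
  shows "dyn_mean_landsberg (unicorn f \<phi>) \<mu> x y = 0"
  by (simp add: dyn_mean_landsberg_def mean_landsberg_cone assms derivatives_of_zero(3)[OF assms mean_landsberg_cone])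

lemma chern_mean_landsberg_cone:
  assumes "x \<in> U" "y \<in> cone"
  shows "chern_mean_landsberg (unicorn f \<phi>) \<mu> \<nu> x y = 0"
  by (simp add: chern_mean_landsberg_def mean_landsberg_cone assms derivatives_of_zero(3)[OF assms mean_landsberg_cone])

lemma hder_nonlin_cone:
  assumes x: "x \<in> U" and y: "y \<in> cone"
  shows "hder (unicorn f \<phi>) \<mu> (nonlin (unicorn f \<phi>) \<rho> \<nu>) x y =
    H1 (x $ 0) * (ltime \<mu> * M \<rho> \<nu> y) - (H (x $ 0))\<^sup>2 * (\<Sum>\<sigma>\<in>UNIV. M \<sigma> \<mu> y * M2 \<rho> \<nu> \<sigma> y)"
proof -
  have 1: "pdx \<mu> (nonlin (unicorn f \<phi>) \<rho> \<nu>) x y = H1 (x $ 0) * M \<rho> \<nu> y * ltime \<mu>"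
    by (rule pdx_eqI[OF open_U x, where h' = "\<lambda>t. H t * M \<rho> \<nu> y"], erule nonlin_cone[OF _ y])
       (rule DERIV_cmult_right[OF DERIV_H[OF x]])
  have 2: "pdy \<sigma> (nonlin (unicorn f \<phi>) \<rho> \<nu>) x y = H (x $ 0) * M2 \<rho> \<nu> \<sigma> y" for \<sigma>
    by (rule pdy_eqI[OF open_cone y, where h' = "\<lambda>y. H (x $ 0) * M \<rho> \<nu> y"], erule nonlin_cone[OF x])
       (intro DERIV_cmult DERIV_M_line y)
  show ?thesis
    unfolding hder_def 1 2 nonlin_cone[OF x y] sum_distrib_left
    by (simp add: power2_eq_square ac_simps)
qed

section \<open>The Ricci curvature\<close>

definition P :: "real ^ 4 \<Rightarrow> real" where
  "P y = 3 * (y $ 0)\<^sup>2 + 4 * s * y $ 0 * w y + \<epsilon> * qform \<phi> y"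

text \<open>The covector is the differential of y^0 + s w, and it is the coefficient of
  \<open>zspat\<close> in \<open>M\<close>. The second contraction is Euler's identity for
  w.\<close>

lemma b_contr:
  assumes y: "y \<in> cone"
  shows "(\<Sum>\<mu>\<in>UNIV. (ltime \<mu> + s * \<epsilon> * p \<mu> y * v y) * ltime \<mu>) = 1"
    and "(\<Sum>\<mu>\<in>UNIV. (ltime \<mu> + s * \<epsilon> * p \<mu> y * v y) * zspat y \<mu>) = s * w y"
proof -
  have 1: "(\<Sum>\<mu>\<in>UNIV. (ltime \<mu> + s * \<epsilon> * p \<mu> y * v y) * h \<mu>)
     = (\<Sum>\<mu>\<in>UNIV. ltime \<mu> * h \<mu>) + s * \<epsilon> * v y * (\<Sum>\<mu>\<in>UNIV. p \<mu> y * h \<mu>)" for h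
    unfolding sum_distrib_left sum.distrib[symmetric] by (intro sum.cong refl) (simp add: algebra_simps)
  have 2: "(\<Sum>\<mu>\<in>UNIV. p \<mu> y * ltime \<mu>) = 0"
    using contractions(8)[of \<phi> y] by (simp add: mult.commute)
  have "s * \<epsilon> * v y * (\<epsilon> * (w y)\<^sup>2) = s * (\<epsilon> * \<epsilon>) * (v y * w y) * w y"
    by (simp add: power2_eq_square)
  then have 3: "s * \<epsilon> * v y * (\<epsilon> * (w y)\<^sup>2) = s * w y"
    unfolding eps_square vw[OF y] by simp
  show "(\<Sum>\<mu>\<in>UNIV. (ltime \<mu> + s * \<epsilon> * p \<mu> y * v y) * ltime \<mu>) = 1"
    unfolding 1 contractions 2 by simp
  show "(\<Sum>\<mu>\<in>UNIV. (ltime \<mu> + s * \<epsilon> * p \<mu> y * v y) * zspat y \<mu>) = s * w y"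
    unfolding 1 contractions coneD(6)[OF y] 3 by simp
qed

text \<open>The coefficient of \<open>ltime\<close> in \<open>M\<close>, half the gradient of
  (y^0)^2 - w^2.\<close>

lemma a_contr:
  shows "(\<Sum>\<mu>\<in>UNIV. (y $ 0 * ltime \<mu> - \<epsilon> * p \<mu> y) * ltime \<mu>) = y $ 0"
    and "(\<Sum>\<mu>\<in>UNIV. (y $ 0 * ltime \<mu> - \<epsilon> * p \<mu> y) * zspat y \<mu>) = - \<epsilon> * qform \<phi> y"
proof -
  have 1: "(\<Sum>\<mu>\<in>UNIV. (y $ 0 * ltime \<mu> - \<epsilon> * p \<mu> y) * h \<mu>)
     = y $ 0 * (\<Sum>\<mu>\<in>UNIV. ltime \<mu> * h \<mu>) - \<epsilon> * (\<Sum>\<mu>\<in>UNIV. p \<mu> y * h \<mu>)" for h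
    unfolding sum_distrib_left sum_subtractf[symmetric] by (intro sum.cong refl) (simp add: algebra_simps)
  have 2: "(\<Sum>\<mu>\<in>UNIV. p \<mu> y * ltime \<mu>) = 0"
    using contractions(8)[of \<phi> y] by (simp add: mult.commute)
  show "(\<Sum>\<mu>\<in>UNIV. (y $ 0 * ltime \<mu> - \<epsilon> * p \<mu> y) * ltime \<mu>) = y $ 0"
    and "(\<Sum>\<mu>\<in>UNIV. (y $ 0 * ltime \<mu> - \<epsilon> * p \<mu> y) * zspat y \<mu>) = - \<epsilon> * qform \<phi> y"
    unfolding 1 contractions 2 by simp_all
qed

lemma trace_M:
  assumes y: "y \<in> cone"
  shows "(\<Sum>\<mu>\<in>UNIV. M \<mu> \<mu> y) = 4 * (y $ 0 + s * w y)"
proof -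
  have "(\<Sum>\<mu>\<in>UNIV. M \<mu> \<mu> y) = (\<Sum>\<mu>\<in>UNIV. (y $ 0 * ltime \<mu> - \<epsilon> * p \<mu> y) * ltime \<mu>)
    + (\<Sum>\<mu>\<in>UNIV. (ltime \<mu> + s * \<epsilon> * p \<mu> y * v y) * zspat y \<mu>) + (y $ 0 + s * w y) * (\<Sum>\<mu>\<in>UNIV. kron \<mu> \<mu>)"
    unfolding M_def sum.distrib sum_distrib_left ..
  then show ?thesis unfolding a_contr b_contr[OF y] contractions by simp
qed

text \<open>The right-hand side is the gradient of the trace in \<open>trace_M\<close>.\<close>

lemma trace_M2:
  assumes y: "y \<in> cone"
  shows "(\<Sum>\<mu>\<in>UNIV. M2 \<mu> \<mu> \<sigma> y) = 4 * (ltime \<sigma> + s * \<epsilon> * p \<sigma> y * v y)"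
proof -
  have "(\<Sum>\<mu>\<in>UNIV. M2 \<mu> \<mu> \<sigma> y) = ltime \<sigma> * (\<Sum>\<mu>\<in>UNIV. ltime \<mu> * ltime \<mu>) - \<epsilon> * (\<Sum>\<mu>\<in>UNIV. ltime \<mu> * Q \<mu> \<sigma>)
     + s * \<epsilon> * (\<Sum>\<mu>\<in>UNIV. V \<mu> \<sigma> y * zspat y \<mu>) + (\<Sum>\<mu>\<in>UNIV. ltime \<mu> * kron \<mu> \<sigma>)
     + s * \<epsilon> * v y * (\<Sum>\<mu>\<in>UNIV. kron \<sigma> \<mu> * p \<mu> y)
     + (ltime \<sigma> + s * \<epsilon> * p \<sigma> y * v y) * (\<Sum>\<mu>\<in>UNIV. kron \<mu> \<mu>)"
    unfolding M2_def sum_distrib_left sum.distrib[symmetric] sum_subtractf[symmetric]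
    by (intro sum.cong refl) (simp add: algebra_simps kron_sym)
  then show ?thesis unfolding contractions V_contr[OF y] by simp
qed

text \<open>Since \<open>N\<close> is homogeneous of degree one and \<open>\<partial>\<^sub>\<sigma>N\<^sup>\<rho>\<^sub>\<nu>\<close> is symmetric in the lower indices, contracting
  the curvature with \<open>y\<close> leaves \<open>G\<^sup>\<sigma>\<partial>\<^sub>\<sigma>N\<^sup>\<mu>\<^sub>\<mu> - N\<^sup>\<sigma>\<^sub>\<mu>N\<^sup>\<mu>\<^sub>\<sigma>\<close> as coefficient of \<open>H\<^sup>2\<close>; both terms equal
  \<open>4 (u + w)\<^sup>2\<close>.\<close>

lemma Ric_cone:
  assumes x: "x \<in> U" and y: "y \<in> cone"
  shows "Ric (unicorn f \<phi>) x y = - H1 (x $ 0) * P y"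
proof -
  have "Ric (unicorn f \<phi>) x y = (\<Sum>\<mu>\<in>UNIV. \<Sum>\<nu>\<in>UNIV.
      H1 (x $ 0) * (ltime \<mu> * (M \<mu> \<nu> y * y $ \<nu>)) - H1 (x $ 0) * (M \<mu> \<mu> y * (ltime \<nu> * y $ \<nu>))
      - (H (x $ 0))\<^sup>2 * (\<Sum>\<sigma>\<in>UNIV. M \<sigma> \<mu> y * (M2 \<mu> \<nu> \<sigma> y * y $ \<nu>))
      + (H (x $ 0))\<^sup>2 * (\<Sum>\<sigma>\<in>UNIV. M2 \<mu> \<mu> \<sigma> y * (M \<sigma> \<nu> y * y $ \<nu>)))"
    unfolding Ric_def curv_def hder_nonlin_cone[OF x y]
    by (intro sum.cong refl) (simp add: algebra_simps sum_distrib_left)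
  also have "\<dots> = H1 (x $ 0) * ((\<Sum>\<mu>\<in>UNIV. ltime \<mu> * (\<Sum>\<nu>\<in>UNIV. M \<mu> \<nu> y * y $ \<nu>))
        - (\<Sum>\<mu>\<in>UNIV. M \<mu> \<mu> y) * (\<Sum>\<nu>\<in>UNIV. ltime \<nu> * y $ \<nu>))
      - (H (x $ 0))\<^sup>2 * ((\<Sum>\<mu>\<in>UNIV. \<Sum>\<sigma>\<in>UNIV. M \<sigma> \<mu> y * (\<Sum>\<nu>\<in>UNIV. M2 \<mu> \<nu> \<sigma> y * y $ \<nu>))
       - (\<Sum>\<sigma>\<in>UNIV. (\<Sum>\<mu>\<in>UNIV. M2 \<mu> \<mu> \<sigma> y) * (\<Sum>\<nu>\<in>UNIV. M \<sigma> \<nu> y * y $ \<nu>)))"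
  proof -
    have a: "(\<Sum>\<mu>\<in>UNIV. \<Sum>\<nu>\<in>UNIV. (\<Sum>\<sigma>\<in>UNIV. M \<sigma> \<mu> y * (M2 \<mu> \<nu> \<sigma> y * y $ \<nu>)))
      = (\<Sum>\<mu>\<in>UNIV. \<Sum>\<sigma>\<in>UNIV. M \<sigma> \<mu> y * (\<Sum>\<nu>\<in>UNIV. M2 \<mu> \<nu> \<sigma> y * y $ \<nu>))"
      unfolding sum_distrib_left by (intro sum.cong refl sum.swap)
    have "(\<Sum>\<mu>\<in>UNIV. \<Sum>\<nu>\<in>UNIV. (\<Sum>\<sigma>\<in>UNIV. M2 \<mu> \<mu> \<sigma> y * (M \<sigma> \<nu> y * y $ \<nu>)))
      = (\<Sum>\<mu>\<in>UNIV. \<Sum>\<sigma>\<in>UNIV. M2 \<mu> \<mu> \<sigma> y * (\<Sum>\<nu>\<in>UNIV. M \<sigma> \<nu> y * y $ \<nu>))"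
      unfolding sum_distrib_left by (intro sum.cong refl sum.swap)
    also have "\<dots> = (\<Sum>\<sigma>\<in>UNIV. (\<Sum>\<mu>\<in>UNIV. M2 \<mu> \<mu> \<sigma> y) * (\<Sum>\<nu>\<in>UNIV. M \<sigma> \<nu> y * y $ \<nu>))"
      unfolding sum_distrib_right by (rule sum.swap)
    finally have b: "(\<Sum>\<mu>\<in>UNIV. \<Sum>\<nu>\<in>UNIV. (\<Sum>\<sigma>\<in>UNIV. M2 \<mu> \<mu> \<sigma> y * (M \<sigma> \<nu> y * y $ \<nu>)))
      = (\<Sum>\<sigma>\<in>UNIV. (\<Sum>\<mu>\<in>UNIV. M2 \<mu> \<mu> \<sigma> y) * (\<Sum>\<nu>\<in>UNIV. M \<sigma> \<nu> y * y $ \<nu>))" .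
    have c: "(\<Sum>\<mu>\<in>UNIV. \<Sum>\<nu>\<in>UNIV. ltime \<mu> * (M \<mu> \<nu> y * y $ \<nu>)) = (\<Sum>\<mu>\<in>UNIV. ltime \<mu> * (\<Sum>\<nu>\<in>UNIV. M \<mu> \<nu> y * y $ \<nu>))"
      unfolding sum_distrib_left ..
    have d: "(\<Sum>\<mu>\<in>UNIV. \<Sum>\<nu>\<in>UNIV. M \<mu> \<mu> y * (ltime \<nu> * y $ \<nu>)) = (\<Sum>\<mu>\<in>UNIV. M \<mu> \<mu> y) * (\<Sum>\<nu>\<in>UNIV. ltime \<nu> * y $ \<nu>)"
      unfolding sum_distrib_left sum_distrib_right by (rule sum.swap)
    show ?thesis
      unfolding sum.distrib sum_subtractf sum_distrib_left[of "H1 (x $ 0)", symmetric]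
        sum_distrib_left[of "(H (x $ 0))\<^sup>2", symmetric] a b c d
      by (simp only: right_diff_distrib)
  qed
  also have "(\<Sum>\<mu>\<in>UNIV. \<Sum>\<sigma>\<in>UNIV. M \<sigma> \<mu> y * (\<Sum>\<nu>\<in>UNIV. M2 \<mu> \<nu> \<sigma> y * y $ \<nu>))
     - (\<Sum>\<sigma>\<in>UNIV. (\<Sum>\<mu>\<in>UNIV. M2 \<mu> \<mu> \<sigma> y) * (\<Sum>\<nu>\<in>UNIV. M \<sigma> \<nu> y * y $ \<nu>)) = 0"
  proof -
    define c where "c = y $ 0 + s * w y"
    have 1: "(\<Sum>\<mu>\<in>UNIV. \<Sum>\<sigma>\<in>UNIV. M \<sigma> \<mu> y * (\<Sum>\<nu>\<in>UNIV. M2 \<mu> \<nu> \<sigma> y * y $ \<nu>))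
      = (y $ 0)\<^sup>2 + 2 * (- \<epsilon> * qform \<phi> y) * 1 + (s * w y)\<^sup>2 + 2 * c * (s * w y) + 3 * c\<^sup>2"
      unfolding M2_contr[OF y] unfolding M_def trace_square a_contr b_contr[OF y] c_def ..
    have "(\<Sum>\<sigma>\<in>UNIV. (\<Sum>\<mu>\<in>UNIV. M2 \<mu> \<mu> \<sigma> y) * (\<Sum>\<nu>\<in>UNIV. M \<sigma> \<nu> y * y $ \<nu>))
      = 4 * (((y $ 0)\<^sup>2 - \<epsilon> * qform \<phi> y) * (\<Sum>\<sigma>\<in>UNIV. (ltime \<sigma> + s * \<epsilon> * p \<sigma> y * v y) * ltime \<sigma>)
        + 2 * c * (\<Sum>\<sigma>\<in>UNIV. (ltime \<sigma> + s * \<epsilon> * p \<sigma> y * v y) * zspat y \<sigma>))"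
      unfolding trace_M2[OF y] M_contr[OF y] Gs_def sum_distrib_left sum.distrib[symmetric] c_def
      by (intro sum.cong refl) (simp add: algebra_simps)
    then have 2: "(\<Sum>\<sigma>\<in>UNIV. (\<Sum>\<mu>\<in>UNIV. M2 \<mu> \<mu> \<sigma> y) * (\<Sum>\<nu>\<in>UNIV. M \<sigma> \<nu> y * y $ \<nu>))
      = 4 * (((y $ 0)\<^sup>2 - \<epsilon> * qform \<phi> y) + 2 * c * (s * w y))"
      unfolding b_contr[OF y] by simp
    have 3: "\<epsilon> * qform \<phi> y = (w y)\<^sup>2" using coneD[OF y] by simp
    have 4: "(s * w y)\<^sup>2 = (w y)\<^sup>2" by (simp add: power_mult_distrib s_square)
    \<comment> \<open>After eliminating y^0, all terms in \<open>c\<close> cancel identically and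
      only a multiple of w^2 - (s w)^2 is left.\<close>
    have y0: "y $ 0 = c - s * w y" by (simp add: c_def)
    have "(y $ 0)\<^sup>2 + 2 * (- (w y)\<^sup>2) + (w y)\<^sup>2 + 2 * c * (s * w y) + 3 * c\<^sup>2
       - 4 * (((y $ 0)\<^sup>2 - (w y)\<^sup>2) + 2 * c * (s * w y)) = 3 * ((w y)\<^sup>2 - (s * w y)\<^sup>2)"
      unfolding y0 by (simp add: algebra_simps power2_eq_square)
    then show ?thesis unfolding 1 2 by (simp add: 3 4)
  qed
  also have "(\<Sum>\<mu>\<in>UNIV. ltime \<mu> * (\<Sum>\<nu>\<in>UNIV. M \<mu> \<nu> y * y $ \<nu>)) = (y $ 0)\<^sup>2 - \<epsilon> * qform \<phi> y"
  proof -
    have "(\<Sum>\<mu>\<in>UNIV. ltime \<mu> * Gs \<mu> y) = ((y $ 0)\<^sup>2 - \<epsilon> * qform \<phi> y) * (\<Sum>\<mu>\<in>UNIV. ltime \<mu> * ltime \<mu>)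
        + 2 * (y $ 0 + s * w y) * (\<Sum>\<mu>\<in>UNIV. ltime \<mu> * zspat y \<mu>)"
      unfolding Gs_def sum_distrib_left sum.distrib[symmetric]
      by (intro sum.cong refl) (simp add: algebra_simps)
    then show ?thesis unfolding M_contr[OF y] contractions by simp
  qed
  also have "(y $ 0)\<^sup>2 - \<epsilon> * qform \<phi> y - (\<Sum>\<mu>\<in>UNIV. M \<mu> \<mu> y) * (\<Sum>\<nu>\<in>UNIV. ltime \<nu> * y $ \<nu>) = - P y"
    unfolding trace_M[OF y] contractions P_def by (simp add: algebra_simps power2_eq_square)
  finally show ?thesis by simp
qed

text \<open>\<open>P1\<close> and \<open>P2\<close> are half the gradient and half the Hessian of \<open>P\<close>.\<close>

definition P1 :: "4 \<Rightarrow> real ^ 4 \<Rightarrow> real" where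
  "P1 \<nu> y = 3 * y $ 0 * ltime \<nu> + 2 * s * (w y * ltime \<nu> + y $ 0 * \<epsilon> * p \<nu> y * v y) + \<epsilon> * p \<nu> y"

definition P2 :: "4 \<Rightarrow> 4 \<Rightarrow> real ^ 4 \<Rightarrow> real" where
  "P2 \<mu> \<nu> y = (3 * ltime \<mu> + 2 * s * \<epsilon> * v y * p \<mu> y) * ltime \<nu>
     + (2 * s * \<epsilon> * v y * ltime \<mu> - 2 * u y * v y ^ 3 * p \<mu> y) * p \<nu> y
     + (2 * u y * \<epsilon> * v y + \<epsilon>) * Q \<mu> \<nu>"

lemma DERIV_P_line:
  assumes "y \<in> cone"
  shows "((\<lambda>t. P (y + t *\<^sub>R axis \<mu> 1)) has_real_derivative 2 * P1 \<mu> y) (at 0)"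
  unfolding P_def P1_def
  by (rule derivative_eq_intros DERIV_nth0_line DERIV_w_line'[OF assms] DERIV_qform_line[OF transpose_phi] refl)+
     (simp add: algebra_simps)

lemma DERIV_P1_line:
  assumes "y \<in> cone"
  shows "((\<lambda>t. P1 \<nu> (y + t *\<^sub>R axis \<mu> 1)) has_real_derivative P2 \<mu> \<nu> y) (at 0)"
  unfolding P1_def P2_def u_def
  by (rule derivative_eq_intros DERIV_nth0_line DERIV_w_line'[OF assms] DERIV_v_line[OF assms] DERIV_qlow_line refl)+
     (simp add: algebra_simps eps_square Q_sym)

lemma ricci_tensor_cone:
  assumes x: "x \<in> U" and y: "y \<in> cone"
  shows "ricci_tensor (unicorn f \<phi>) \<mu> \<nu> x y = - H1 (x $ 0) * P2 \<mu> \<nu> y"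
proof -
  have 1: "pdy \<nu> (Ric (unicorn f \<phi>)) x y = - H1 (x $ 0) * (2 * P1 \<nu> y)" if "y \<in> cone" for y
    by (rule pdy_eqI[OF open_cone that, where h' = "\<lambda>y. - H1 (x $ 0) * P y"], erule Ric_cone[OF x])
       (intro DERIV_cmult DERIV_P_line that)
  have 2: "pdy \<mu> (pdy \<nu> (Ric (unicorn f \<phi>))) x y = - H1 (x $ 0) * (2 * P2 \<mu> \<nu> y)"
    by (rule pdy_eqI[OF open_cone y, where h' = "\<lambda>y. - H1 (x $ 0) * (2 * P1 \<nu> y)"], erule 1)
       (intro DERIV_cmult DERIV_P1_line y)
  then show ?thesis by (simp add: ricci_tensor_def)
qed

text \<open>The Hessian \<open>P2\<close> consists of the same kinds of terms as the metric, so
  \<open>bilinear_contraction\<close> gives its product with the inverse metric and the trace is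
  taken afterwards.\<close>

lemma gi_P2_contr:
  assumes y: "y \<in> cone"
  shows "(\<Sum>\<mu>\<in>UNIV. \<Sum>\<nu>\<in>UNIV. gi y \<mu> \<nu> * P2 \<mu> \<nu> y) =
     3 * (u y)\<^sup>2 + 2 * u y * w y - (w y)\<^sup>2 + (4 * u y * v y + 3) * (u y + w y)\<^sup>2"
proof -
  define a' b' c' d' where "a' = (u y)\<^sup>2 + (w y)\<^sup>2" and "b' = - 2 * s * w y"
    and "c' = (u y + w y)\<^sup>2 * \<epsilon>" and "d' = 2 * (u y + 2 * w y) * v y"
  define \<eta> \<kappa>1 \<kappa>2 where "\<eta> = 2 * s * \<epsilon> * v y" and "\<kappa>1 = 2 * u y * \<epsilon> * v y + \<epsilon>"
    and "\<kappa>2 = 2 * u y * v y ^ 3"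
  have gi: "gi y \<nu> \<rho> = (a' * ltime \<rho> + b' * zspat y \<rho>) * ltime \<nu>
      + (b' * ltime \<rho> + d' * zspat y \<rho>) * zspat y \<nu> + c' * R \<nu> \<rho>" for \<nu> \<rho>
    unfolding gi_def a'_def b'_def c'_def d'_def v_def
    by (simp add: divide_inverse algebra_simps)
  have P2: "P2 \<mu> \<nu> y = (3 * ltime \<mu> + \<eta> * p \<mu> y) * ltime \<nu> + (\<eta> * ltime \<mu> - \<kappa>2 * p \<mu> y) * p \<nu> y + \<kappa>1 * Q \<mu> \<nu>" for \<mu> \<nu>
    unfolding P2_def \<eta>_def \<kappa>1_def \<kappa>2_def by (simp add: algebra_simps)
  have sym: "P2 \<mu> \<nu> y = P2 \<nu> \<mu> y" for \<mu> \<nu>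
    unfolding P2 by (simp add: algebra_simps Q_sym)
  have q: "qform \<phi> y = \<epsilon> * (w y)\<^sup>2" using coneD[OF y] by simp
  \<comment> \<open>The symmetry of \<open>P2\<close> brings the double sum into the form of a
    matrix product, row times column.\<close>
  have "(\<Sum>\<mu>\<in>UNIV. \<Sum>\<nu>\<in>UNIV. gi y \<mu> \<nu> * P2 \<mu> \<nu> y) = (\<Sum>\<nu>\<in>UNIV. \<Sum>\<mu>\<in>UNIV. P2 \<nu> \<mu> y * gi y \<mu> \<nu>)"
    by (subst sum.swap) (intro sum.cong refl, simp add: sym mult.commute)
  also have "\<dots> = (\<Sum>\<rho>\<in>UNIV.
      (3 * ltime \<rho> + \<eta> * p \<rho> y) * (a' * ltime \<rho> + b' * zspat y \<rho>)
      + (\<eta> * ltime \<rho> - \<kappa>2 * p \<rho> y) * (b' * ltime \<rho> + d' * zspat y \<rho>) * qform \<phi> y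
      + (\<eta> * ltime \<rho> - \<kappa>2 * p \<rho> y) * c' * zspat y \<rho>
      + \<kappa>1 * (b' * ltime \<rho> + d' * zspat y \<rho>) * p \<rho> y + \<kappa>1 * c' * kron \<rho> \<rho>)"
    unfolding P2 gi bilinear_contraction ..
  also have "\<dots> = (3 * a' + \<eta> * b' * qform \<phi> y) * (\<Sum>\<rho>\<in>UNIV. ltime \<rho> * ltime \<rho>)
      + (3 * b' + \<eta> * d' * qform \<phi> y + \<eta> * c') * (\<Sum>\<rho>\<in>UNIV. ltime \<rho> * zspat y \<rho>)
      + (\<eta> * a' - \<kappa>2 * b' * qform \<phi> y + \<kappa>1 * b') * (\<Sum>\<rho>\<in>UNIV. ltime \<rho> * p \<rho> y)
      + (\<eta> * b' - \<kappa>2 * d' * qform \<phi> y - \<kappa>2 * c' + \<kappa>1 * d') * (\<Sum>\<rho>\<in>UNIV. p \<rho> y * zspat y \<rho>)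
      + \<kappa>1 * c' * (\<Sum>\<rho>\<in>UNIV. kron \<rho> \<rho>)"
    unfolding sum_distrib_left sum.distrib[symmetric]
    by (intro sum.cong refl) (simp add: algebra_simps)
  also have "\<dots> = 3 * a' + 2 * \<eta> * b' * qform \<phi> y - \<kappa>2 * d' * (qform \<phi> y)\<^sup>2 - \<kappa>2 * c' * qform \<phi> y
      + \<kappa>1 * d' * qform \<phi> y + 3 * \<kappa>1 * c'"
    unfolding contractions by (simp add: algebra_simps power2_eq_square)
  also have "\<dots> = 3 * ((u y)\<^sup>2 + (w y)\<^sup>2) - 8 * (s * s) * (\<epsilon> * \<epsilon>) * (v y * w y) * (w y)\<^sup>2
      - 4 * u y * (\<epsilon> * \<epsilon>) * (u y + 2 * w y) * (v y * w y) * (v y * w y) * (v y * w y) * (v y * w y)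
      - 2 * u y * (\<epsilon> * \<epsilon>) * v y * (u y + w y)\<^sup>2 * (v y * w y) * (v y * w y)
      + (\<epsilon> * \<epsilon>) * (2 * u y * (v y * w y) + w y) * 2 * (u y + 2 * w y) * (v y * w y)
      + 3 * (\<epsilon> * \<epsilon>) * (2 * u y * v y + 1) * (u y + w y)\<^sup>2"
    unfolding q a'_def b'_def c'_def d'_def \<eta>_def \<kappa>1_def \<kappa>2_def
    by (simp add: algebra_simps power2_eq_square power3_eq_cube)
  also have "\<dots> = 3 * (u y)\<^sup>2 + 2 * u y * w y - (w y)\<^sup>2 + (4 * u y * v y + 3) * (u y + w y)\<^sup>2"
    unfolding s_square eps_square vw[OF y] by (simp add: algebra_simps power2_eq_square)
  finally show ?thesis .
qed

text \<open>Since L g^{\<mu>\<nu>} is free of f, the base point enters only through H'. The Ricci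
  terms combine to 2/3 H' (3 P - K), where K is the trace of \<open>P2\<close>; the stated product
  is the factorization of K - 3 P.\<close>

lemma PW_expression:
  assumes x: "x \<in> U" and y: "y \<in> cone"
  defines "F \<equiv> unicorn f \<phi>"
  shows "- 2 * Ric F x y
     + 2 * lagr F x y / 3 *
         (\<Sum>\<mu>\<in>UNIV. \<Sum>\<nu>\<in>UNIV. fund_inv F x y $ \<mu> $ \<nu> * ricci_tensor F \<mu> \<nu> x y)
     + 2 * lagr F x y / 3 *
         (\<Sum>\<mu>\<in>UNIV. \<Sum>\<nu>\<in>UNIV. fund_inv F x y $ \<mu> $ \<nu> *
            (pdy \<mu> (dyn_mean_landsberg F \<nu>) x y
             - mean_landsberg F \<mu> x y * mean_landsberg F \<nu> x y
             + chern_mean_landsberg F \<mu> \<nu> x y))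
    = - 2 / 3 * H1 (x $ 0) * ((u y + w y) * (4 * (u y)\<^sup>2 + u y * w y - (w y)\<^sup>2) / w y)"
proof -
  define L where "L = (f (x $ 0))\<^sup>2 * ((u y + w y)\<^sup>2 * expw y)"
  have L0: "L \<noteq> 0"
    using f_pos[OF x] coneD[OF y] by (auto simp: expw_def L_def)
  define K where "K = 3 * (u y)\<^sup>2 + 2 * u y * w y - (w y)\<^sup>2 + (4 * u y * v y + 3) * (u y + w y)\<^sup>2"
  have 1: "(\<Sum>\<mu>\<in>UNIV. \<Sum>\<nu>\<in>UNIV. fund_inv F x y $ \<mu> $ \<nu> * ricci_tensor F \<mu> \<nu> x y)
      = - H1 (x $ 0) / L * K"
    unfolding F_def fund_inv_cone(1)[OF x y] ricci_tensor_cone[OF x y] L_def[symmetric] vec_lambda_beta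
      K_def gi_P2_contr[OF y, symmetric] sum_distrib_left
    by (intro sum.cong refl) simp
  have 2: "lagr F x y = L" unfolding F_def lagr_cone[OF y] L_def ..
  have 3: "Ric F x y = - H1 (x $ 0) * P y" unfolding F_def by (rule Ric_cone[OF x y])
  have 4: "(\<Sum>\<mu>\<in>UNIV. \<Sum>\<nu>\<in>UNIV. fund_inv F x y $ \<mu> $ \<nu> *
            (pdy \<mu> (dyn_mean_landsberg F \<nu>) x y
             - mean_landsberg F \<mu> x y * mean_landsberg F \<nu> x y
             + chern_mean_landsberg F \<mu> \<nu> x y)) = 0"
    unfolding F_def by (simp add: mean_landsberg_cone[OF x y] chern_mean_landsberg_cone[OF x y]
       derivatives_of_zero(2)[OF x y dyn_mean_landsberg_cone])
  have "P y = 3 * (u y)\<^sup>2 + 4 * u y * w y + (w y)\<^sup>2"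
    unfolding P_def u_sq coneD(4)[OF y, symmetric] by (simp add: u_def)
  then have "3 * P y - K = (u y + w y) * (3 * u y + w y - 4 * (u y)\<^sup>2 * v y - 4 * u y * (v y * w y))"
    unfolding K_def by (simp add: algebra_simps power2_eq_square)
  moreover have "(u y + w y) * (4 * (u y)\<^sup>2 + u y * w y - (w y)\<^sup>2) / w y
     = (u y + w y) * (4 * (u y)\<^sup>2 * v y + u y * (v y * w y) - w y * (v y * w y))"
    by (simp add: v_def divide_inverse algebra_simps power2_eq_square)
  ultimately have 5: "(u y + w y) * (4 * (u y)\<^sup>2 + u y * w y - (w y)\<^sup>2) / w y = - (3 * P y - K)"
    unfolding vw[OF y] by (simp add: algebra_simps)
  have "L / L = 1" using L0 by simp
  have "- 2 * (- H1 (x $ 0) * P y) + 2 * L / 3 * (- H1 (x $ 0) / L * K) + 2 * L / 3 * 0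
    = 2 * H1 (x $ 0) * P y - 2 / 3 * H1 (x $ 0) * K * (L / L)"
    by simp
  also have "\<dots> = - 2 / 3 * H1 (x $ 0) * - (3 * P y - K)"
    unfolding \<open>L / L = 1\<close> by (simp add: field_simps)
  finally show ?thesis unfolding 1 2 3 4 5 .
qed

text \<open>Ensures that a field equation assumed on the domain can be evaluated at cone points. The
  product of \<open>U\<close> and \<open>cone\<close> serves as the neighbourhood of smoothness, on
  which the metric is assembled from elementary functions.\<close>

lemma cone_subset_domain:
  assumes "open I" "smooth_on I f" "(\<lambda>x. x $ 0) ` U \<subseteq> I" "x \<in> U" "y \<in> cone"
  shows "(x, y) \<in> unicorn_domain U f \<phi>"
proof -
  let ?W = "U \<times> cone"
  have oW: "open ?W" by (intro open_Times open_U open_cone)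
  have lin: "bounded_linear (\<lambda>z :: (real ^ 4) \<times> (real ^ 4). fst z $ i)"
    "bounded_linear (\<lambda>z :: (real ^ 4) \<times> (real ^ 4). snd z $ i)" for i
    by (rule bounded_linear_compose[OF bounded_linear_vec_nth bounded_linear_fst]
          bounded_linear_compose[OF bounded_linear_vec_nth bounded_linear_snd])+
  \<comment> \<open>Writing f as its zeroth iterate matches the form \<open>g j\<close> in the rule
    \<open>chain\<close>.\<close>
  have ef: "elementary_on ?W (\<lambda>z. (deriv ^^ 0) f (fst z $ 0))"
    by (rule elementary_on.chain[OF elementary_on.linear[OF lin(1)], where g = "\<lambda>j. (deriv ^^ j) f"])
       (use smooth_on_real_DERIV[OF assms(1,2)] assms(3) in auto)
  have eu: "elementary_on ?W (\<lambda>z. u (snd z))"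
    unfolding u_def by (intro elementary_on.mult elementary_on.const elementary_on.linear lin)
  have eq: "elementary_on ?W (\<lambda>z. \<epsilon> * qform \<phi> (snd z))"
    unfolding qform_eq qlow_def
    by (intro elementary_on.mult elementary_on_sum elementary_on.const elementary_on.linear lin finite)
  have ew: "elementary_on ?W (\<lambda>z. w (snd z))"
    unfolding w_def by (intro elementary_on.mult elementary_on.const elementary_on.sqrt eq)
      (auto dest: coneD(7))
  have ei: "elementary_on ?W (\<lambda>z. inverse (u (snd z) + w (snd z)))"
    by (intro elementary_on.inverse elementary_on.add eu ew) (auto dest: coneD(3))
  \<comment> \<open>The exponential is its own derivative, so the sequence of derivatives is
    constant.\<close>
  have ex: "elementary_on ?W (\<lambda>z. exp (u (snd z) * inverse (u (snd z) + w (snd z))))"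
    by (rule elementary_on.chain[OF elementary_on.mult[OF eu ei], where g = "\<lambda>_. exp"])
       (auto intro!: derivative_eq_intros)
  have "elementary_on ?W (\<lambda>z. (deriv ^^ 0) f (fst z $ 0) * (u (snd z) + w (snd z)) *
      exp (u (snd z) * inverse (u (snd z) + w (snd z))))"
    by (intro elementary_on.mult elementary_on.add ef eu ew ex)
  from elementary_on_smooth[OF oW this]
  have "Ck_on k ?W (\<lambda>(x, y). unicorn f \<phi> x y)" for k
    unfolding smooth_on_def
    by (intro Ck_on_cong[OF oW _ spec[of _ k]]) (auto simp: unicorn_on_cone(3))
  then have "smooth_on ?W (\<lambda>(x, y). unicorn f \<phi> x y)" by (simp add: smooth_on_def)
  moreover have "y $ 0 \<noteq> 0" "qform \<phi> y \<noteq> 0" "unicorn_base \<phi> y \<noteq> 0"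
    using coneD[OF assms(5)] unicorn_on_cone[OF assms(5)] by auto
  ultimately show ?thesis
    unfolding unicorn_domain_def using assms(4,5) oW fund_inv_cone(2)[OF assms(4,5)] by blast
qed

end

section \<open>The field equation\<close>

text \<open>Polarization: basis vectors and their pairwise sums recover every entry of a symmetric
  matrix from its quadratic form, so a vanishing form would force a zero matrix, which is not
  invertible.\<close>

lemma qform_nonzero:
  assumes "transpose \<phi> = \<phi>" "invertible \<phi>"
  shows "\<exists>y. qform \<phi> y \<noteq> 0"
proof (rule ccontr)
  assume "\<not> ?thesis"
  then have z: "qform \<phi> y = 0" for y by simp
  \<comment> \<open>The time component also receives the value \<open>c\<close>; this is harmless
    because \<open>qform\<close> sees only the spatial components.\<close>
  define e :: "real \<Rightarrow> real \<Rightarrow> real \<Rightarrow> real ^ 4" where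
    "e a b c = (\<chi> \<mu>. if \<mu> = 1 then a else if \<mu> = 2 then b else c)" for a b c
  have q: "qform \<phi> (e a b c) = \<phi>$1$1 * a * a + \<phi>$1$2 * a * b + \<phi>$1$3 * a * c + \<phi>$2$1 * b * a + \<phi>$2$2 * b * b + \<phi>$2$3 * b * c
      + \<phi>$3$1 * c * a + \<phi>$3$2 * c * b + \<phi>$3$3 * c * c" for a b c
    by (simp add: qform_def e_def sum_3 spatial_def)
  have s: "\<phi>$j$i = \<phi>$i$j" for i j
    using arg_cong[OF assms(1), of "\<lambda>A. A $ i $ j"] by (simp add: transpose_def)
  have "\<phi>$1$1 = 0" "\<phi>$2$2 = 0" "\<phi>$3$3 = 0"
    using q[of 1 0 0] q[of 0 1 0] q[of 0 0 1] z by simp_all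
  moreover from this have "\<phi>$1$2 = 0" "\<phi>$1$3 = 0" "\<phi>$2$3 = 0"
    using q[of 1 1 0] q[of 1 0 1] q[of 0 1 1] z s[of 2 1] s[of 3 1] s[of 3 2] by simp_all
  ultimately have "\<phi> = 0"
    using s[of 2 1] s[of 3 1] s[of 3 2] by (simp add: vec_eq_iff forall_3)
  moreover obtain B where "\<phi> ** B = mat 1" using assms(2) unfolding invertible_def by blast
  ultimately have "(0 ** B) $ 1 $ 1 = (mat 1 :: real ^ 3 ^ 3) $ 1 $ 1" by simp
  then show False by (simp add: mat_def matrix_matrix_mult_def)
qed

text \<open>Shifting a point of \<open>U\<close> along the coordinate axis stays in \<open>U\<close>
  for small shifts. It makes the time interval open, so f has two-sided derivatives at each of its
  points.\<close>

lemma open_nth_image: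
  fixes U :: "(real ^ 'n) set"
  assumes "open U"
  shows "open ((\<lambda>x. x $ i) ` U)"
proof (rule openI)
  fix t assume "t \<in> (\<lambda>x. x $ i) ` U"
  then obtain x where x: "x \<in> U" "t = x $ i" by auto
  define V where "V = (\<lambda>r. x + (r - x $ i) *\<^sub>R axis i 1) -` U"
  have "open V" unfolding V_def by (intro open_vimage assms continuous_intros)
  moreover have "t \<in> V" using x by (simp add: V_def)
  moreover have "V \<subseteq> (\<lambda>x. x $ i) ` U"
  proof
    fix r assume "r \<in> V"
    then show "r \<in> (\<lambda>x. x $ i) ` U"
      unfolding V_def by (intro image_eqI[of _ _ "x + (r - x $ i) *\<^sub>R axis i 1"]) (auto simp: axis_def)
  qed
  ultimately show "\<exists>e>0. ball t e \<subseteq> (\<lambda>x. x $ i) ` U"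
    by (meson open_contains_ball order_trans)
qed

lemma solves_PW_iff_exponential:
  fixes U :: "(real ^ 4) set" and I :: "real set"
    and f :: "real \<Rightarrow> real" and \<phi> :: "real ^ 3 ^ 3"
  assumes "open U" and "is_interval I" and I: "(\<lambda>x. x $ 0) ` U = I"
    and smooth: "smooth_on I f" and pos: "\<forall>t\<in>I. f t > 0"
    and "transpose \<phi> = \<phi>" and "invertible \<phi>"
  shows "solves_PW_vacuum_on (unicorn_domain U f \<phi>) (unicorn f \<phi>)
            \<longleftrightarrow> (\<exists>c1 c2. \<forall>t\<in>I. f t = c1 * exp (c2 * t))"
proof -
  have oI: "open I" using open_nth_image[OF \<open>open U\<close>] I by blast
  have D0: "(f has_real_derivative deriv f t) (at t)"
    and D1: "(deriv f has_real_derivative deriv (deriv f) t) (at t)" if "t \<in> I" for t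
    using smooth_on_real_DERIV[OF oI smooth that, of 0] smooth_on_real_DERIV[OF oI smooth that, of 1]
    by simp_all
  have loc: "unicorn_cone U f (deriv f) (deriv (deriv f)) \<phi> s \<epsilon>"
    if "s = 1 \<or> s = -1" "\<epsilon> = 1 \<or> \<epsilon> = -1" for s \<epsilon>
    using that assms D0 D1 by unfold_locales auto
  \<comment> \<open>\<open>H1\<close> depends on f and its derivatives but not on the signs, so the
    same function serves all instances of the locale.\<close>
  define H' where "H' = unicorn_cone.H1 f (deriv f) (deriv (deriv f))"
  have H'_eq: "H' t = (deriv (deriv f) t * f t - (deriv f t)\<^sup>2) / (f t)\<^sup>2" for t
    unfolding H'_def by (rule unicorn_cone.H1_def[OF loc[of 1 1]]) auto
  show ?thesis
  proof
    assume sol: "solves_PW_vacuum_on (unicorn_domain U f \<phi>) (unicorn f \<phi>)"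
    obtain z where z: "qform \<phi> z \<noteq> 0" using qform_nonzero assms by blast
    \<comment> \<open>The form may be definite, so \<open>\<epsilon>\<close> has to be a sign that
      it actually takes.\<close>
    define \<epsilon> where "\<epsilon> = sgn (qform \<phi> z)"
    interpret unicorn_cone U f "deriv f" "deriv (deriv f)" \<phi> 1 \<epsilon>
      by (rule loc) (use z in \<open>auto simp: \<epsilon>_def sgn_if\<close>)
    \<comment> \<open>Keeping the spatial part preserves w, while the time component is chosen to
      make u exceed the absolute value of w.\<close>
    define y :: "real ^ 4" where "y = (\<chi> \<mu>. if \<mu> = 0 then \<bar>w z\<bar> + 1 else z $ \<mu>)"
    have qy: "qform \<phi> y = qform \<phi> z"
      by (simp add: qform_def y_def spatial_def)
    then have wy: "w y = w z" by (simp add: w_def)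
    have uy: "u y = \<bar>w y\<bar> + 1" unfolding wy by (simp add: u_def y_def)
    have "\<epsilon> * qform \<phi> y > 0" unfolding qy using z by (auto simp: \<epsilon>_def sgn_if)
    moreover have u_pos: "u y > 0" and "u y + w y > 0"
      using uy abs_ge_minus_self[of "w y"] abs_ge_zero[of "w y"] by linarith+
    ultimately have y: "y \<in> cone" unfolding cone_def by simp
    \<comment> \<open>From |w| < u follow u w \<ge> -u^2 and w^2 \<le> u^2, which leave at least 2
      u^2.\<close>
    have "4 * (u y)\<^sup>2 + u y * w y - (w y)\<^sup>2 > 0"
    proof -
      have "\<bar>w y\<bar> * \<bar>w y\<bar> \<le> u y * u y" "u y * \<bar>w y\<bar> \<le> u y * u y"
        unfolding uy by (intro mult_mono; simp)+
      moreover have "u y * (- \<bar>w y\<bar>) \<le> u y * w y"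
        by (rule mult_left_mono) (use uy in linarith)+
      moreover have "u y * u y > 0" using u_pos by simp
      ultimately show ?thesis by (simp add: power2_eq_square)
    qed
    then have nz: "(u y + w y) * (4 * (u y)\<^sup>2 + u y * w y - (w y)\<^sup>2) / w y \<noteq> 0"
      using coneD(1-3)[OF y] by simp
    \<comment> \<open>The cone restricts only the fibre coordinates, so the same \<open>y\<close> is
      available over every base point.\<close>
    have H1_zero: "H1 t = 0" if t: "t \<in> I" for t
    proof -
      obtain x where x: "x \<in> U" "t = x $ 0" using t I by auto
      have "(x, y) \<in> unicorn_domain U f \<phi>"
        by (rule cone_subset_domain[OF oI smooth _ x(1) y]) (simp add: I)
      then have "- 2 / 3 * H1 (x $ 0) * ((u y + w y) * (4 * (u y)\<^sup>2 + u y * w y - (w y)\<^sup>2) / w y) = 0"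
        using bspec[OF sol[unfolded solves_PW_vacuum_on_def]] unfolding PW_expression[OF x(1) y, symmetric]
        by blast
      then show ?thesis using nz x(2) by auto
    qed
    \<comment> \<open>A vanishing derivative gives a single constant only on a connected set; this
      is where the interval enters.\<close>
    have "convex I" using \<open>is_interval I\<close> by (simp add: is_interval_convex)
    have "(H has_real_derivative 0) (at t within I)" if "t \<in> I" for t
      using DERIV_H H1_zero[OF that] that I
      by (metis (no_types, lifting) has_field_derivative_at_within imageE)
    then obtain c2 where c2: "\<forall>t\<in>I. H t = c2"
      using has_field_derivative_zero_constant[OF \<open>convex I\<close>] by blast
    \<comment> \<open>The integrating factor solves f' = c2 f.\<close>
    have "((\<lambda>t. f t * exp (- c2 * t)) has_real_derivative 0) (at t within I)" if t: "t \<in> I" for t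
    proof -
      have "f t \<noteq> 0" "deriv f t / f t = c2" using pos c2 t unfolding H_def by fastforce+
      then have "deriv f t = c2 * f t" by (simp add: field_simps)
      then have "((\<lambda>t. f t * exp (- c2 * t)) has_real_derivative 0) (at t)"
        using D0[OF t] by (auto intro!: derivative_eq_intros)
      then show ?thesis by (rule has_field_derivative_at_within)
    qed
    then obtain c1 where c1: "\<forall>t\<in>I. f t * exp (- c2 * t) = c1"
      using has_field_derivative_zero_constant[OF \<open>convex I\<close>] by blast
    have "f t = c1 * exp (c2 * t)" if "t \<in> I" for t
      using c1 that by (auto simp: exp_minus field_simps)
    then show "\<exists>c1 c2. \<forall>t\<in>I. f t = c1 * exp (c2 * t)" by blast
  next
    assume "\<exists>c1 c2. \<forall>t\<in>I. f t = c1 * exp (c2 * t)"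
    then obtain c1 c2 where f: "\<And>t. t \<in> I \<Longrightarrow> f t = c1 * exp (c2 * t)" by blast
    have f1: "deriv f t = c1 * (c2 * exp (c2 * t))" if t: "t \<in> I" for t
    proof (rule DERIV_imp_deriv, rule has_field_derivative_transform_within_open[OF _ oI t])
      show "((\<lambda>t. c1 * exp (c2 * t)) has_real_derivative c1 * (c2 * exp (c2 * t))) (at t)"
        by (auto intro!: derivative_eq_intros)
    qed (simp add: f)
    have f2: "deriv (deriv f) t = c1 * (c2 * (c2 * exp (c2 * t)))" if t: "t \<in> I" for t
    proof (rule DERIV_imp_deriv, rule has_field_derivative_transform_within_open[OF _ oI t])
      show "((\<lambda>t. c1 * (c2 * exp (c2 * t))) has_real_derivative c1 * (c2 * (c2 * exp (c2 * t)))) (at t)"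
        by (auto intro!: derivative_eq_intros)
    qed (simp add: f1)
    have H'0: "H' t = 0" if "t \<in> I" for t
      unfolding H'_eq f[OF that] f1[OF that] f2[OF that] by (simp add: power2_eq_square)
    show "solves_PW_vacuum_on (unicorn_domain U f \<phi>) (unicorn f \<phi>)"
      unfolding solves_PW_vacuum_on_def
    proof (intro ballI, clarify)
      fix x y assume "(x, y) \<in> unicorn_domain U f \<phi>"
      then have x: "x \<in> U" and y: "y $ 0 \<noteq> 0" "qform \<phi> y \<noteq> 0" "unicorn_base \<phi> y \<noteq> 0"
        by (auto simp: unicorn_domain_def)
      \<comment> \<open>The signs are read off at the given point, which therefore lies in the cone
        of that locale instance.\<close>
      define s \<epsilon> where "s = sgn (y $ 0)" and "\<epsilon> = sgn (qform \<phi> y)"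
      interpret unicorn_cone U f "deriv f" "deriv (deriv f)" \<phi> s \<epsilon>
        by (rule loc) (use y in \<open>auto simp: s_def \<epsilon>_def sgn_if\<close>)
      have uy: "u y = \<bar>y $ 0\<bar>" and eps: "\<epsilon> * qform \<phi> y = \<bar>qform \<phi> y\<bar>"
        unfolding u_def by (simp_all add: s_def \<epsilon>_def abs_sgn mult.commute)
      have "u y + w y = unicorn_base \<phi> y"
        unfolding uy w_def eps unicorn_base_def by (simp only: \<epsilon>_def)
      then have yc: "y \<in> cone"
        using y unfolding cone_def by (simp add: uy eps)
      have "H1 (x $ 0) = 0" using H'0 x I unfolding H'_def by blast
      then show "- 2 * Ric (unicorn f \<phi>) x y
     + 2 * lagr (unicorn f \<phi>) x y / 3 *
         (\<Sum>\<mu>\<in>UNIV. \<Sum>\<nu>\<in>UNIV. fund_inv (unicorn f \<phi>) x y $ \<mu> $ \<nu> * ricci_tensor (unicorn f \<phi>) \<mu> \<nu> x y)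
     + 2 * lagr (unicorn f \<phi>) x y / 3 *
         (\<Sum>\<mu>\<in>UNIV. \<Sum>\<nu>\<in>UNIV. fund_inv (unicorn f \<phi>) x y $ \<mu> $ \<nu> *
            (pdy \<mu> (dyn_mean_landsberg (unicorn f \<phi>) \<nu>) x y
             - mean_landsberg (unicorn f \<phi>) \<mu> x y * mean_landsberg (unicorn f \<phi>) \<nu> x y
             + chern_mean_landsberg (unicorn f \<phi>) \<mu> \<nu> x y)) = 0"
        unfolding PW_expression[OF x yc] by simp
    qed
  qed
qed

lemma unicorn_exponential_iff:
  assumes "(\<lambda>x. x $ 0) ` U = I"
  shows "(\<forall>t\<in>I. f t = c1 * exp (c2 * t)) \<longleftrightarrow> (\<forall>x\<in>U. \<forall>y. unicorn f \<phi> x y = unicorn (\<lambda>t. c1 * exp (c2 * t)) \<phi> x y)"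
proof
  assume "\<forall>t\<in>I. f t = c1 * exp (c2 * t)"
  then show "\<forall>x\<in>U. \<forall>y. unicorn f \<phi> x y = unicorn (\<lambda>t. c1 * exp (c2 * t)) \<phi> x y"
    using assms by (auto simp: unicorn_def)
next
  assume eq: "\<forall>x\<in>U. \<forall>y. unicorn f \<phi> x y = unicorn (\<lambda>t. c1 * exp (c2 * t)) \<phi> x y"
  \<comment> \<open>On the time axis the quadratic form vanishes and the base equals 1, so the
    metric is f(x^0) times the number e and f can be read off. The direction lies outside the domain
    of the field equation, but the identity is assumed for all y.\<close>
  define y :: "real ^ 4" where "y = axis 0 1"
  have "qform \<phi> y = 0"
    by (simp add: qform_def spatial_def y_def axis_def sum_3)
  then have "unicorn_base \<phi> y = 1" by (simp add: unicorn_base_def y_def axis_def)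
  then show "\<forall>t\<in>I. f t = c1 * exp (c2 * t)"
    using eq assms by (auto simp: unicorn_def dest!: spec[of _ y] bspec)
qed

theorem proposition10p2p2:
  fixes U :: "(real ^ 4) set" and I :: "real set"
    and f :: "real \<Rightarrow> real" and \<phi> :: "real ^ 3 ^ 3"
  assumes "open U" and "U \<noteq> {}"
    and "is_interval I" and "(\<lambda>x. x $ 0) ` U = I"
    and "smooth_on I f" and "\<forall>t\<in>I. f t > 0"
    and "transpose \<phi> = \<phi>" and "invertible \<phi>"
  shows "(solves_PW_vacuum_on (unicorn_domain U f \<phi>) (unicorn f \<phi>)
            \<longleftrightarrow> (\<exists>c1 c2. \<forall>t\<in>I. f t = c1 * exp (c2 * t)))
       \<and> (solves_PW_vacuum_on (unicorn_domain U f \<phi>) (unicorn f \<phi>)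
            \<longleftrightarrow> (\<exists>c1 c2. \<forall>x\<in>U. \<forall>y. unicorn f \<phi> x y =
                  (if \<bar>y $ 0\<bar> + sgn (qform \<phi> y) * sqrt \<bar>qform \<phi> y\<bar> \<noteq> 0
                   then c1 * exp (c2 * x $ 0) * (\<bar>y $ 0\<bar> + sgn (qform \<phi> y) * sqrt \<bar>qform \<phi> y\<bar>)
                        * exp (\<bar>y $ 0\<bar> / (\<bar>y $ 0\<bar> + sgn (qform \<phi> y) * sqrt \<bar>qform \<phi> y\<bar>))
                   else 0)))"
  using solves_PW_iff_exponential[OF assms(1,3-8)] unicorn_exponential_iff[OF assms(4), of f _ _ \<phi>]
  unfolding unicorn_def[of "\<lambda>t. _ * exp (_ * t)"] unicorn_base_def by simp

end
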